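(* If $G$ is a Garside group and $A$ is a finitely generated abelian group, then every monomorphism $\phi:A\to G$ is a quasi-isometric embedding.
   Context: Garside groups. Let $M$ be a monoid. An atom is an element $a\in M\setminus\{1\}$ such that $a=bc$ implies $b=1$ or $c=1$. For $a\in M$, $|a|_{\max}$ is the supremum of the lengths of all expressions of $a$ in terms of atoms. $M$ is atomic if it is generated by its atoms and $|a|_{\max}<\infty$ for all $a\in M$. In an atomic monoid, $a\le_L b$ means $ac=b$ for some $c\in M$, and $a\le_R b$ means $ca=b$ for some $c\in M$; these are partial orders. A finitely generated monoid $M$ is a Garside monoid if it is atomic, left and right cancellative, the posets $(M,\le_L)$ and $(M,\le_R)$ are lattices, and there is an element $\Delta\in M$ (a Garside element) such that for every $a\in M$, $a\le_L\Delta$ iff $a\le_R\Delta$, and $\mathcal D=\{a\in M: a\le_L\Delta\}$ generates $M$. A Garside group is the group of fractions of a Garside monoid; it is generated by the finite set $\mathcal D$. Metrics. A finitely generated group with a finite generating set $X$ carries the word metric $d_X(g,h)=|g^{-1}h|_X$, where $|\cdot|_X$ is the shortest word length in the alphabet $X\cup X^{-1}$. $A$ and $G$ are equipped with word metrics with respect to finite generating sets (for $G$ one may take $\mathcal D$; the property of being a quasi-isometric embedding does not depend on the choices). A map $f:X\to Y$ between metric spaces is a $(\lambda,\epsilon)$-quasi-isometric embedding, for constants $\lambda\ge1$, $\epsilon\ge0$, if $\frac1\lambda d_X(x_1,x_2)-\epsilon\le d_Y(f(x_1),f(x_2))\le\lambda d_X(x_1,x_2)+\epsilon$ for all $x_1,x_2\in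 X$; it is a quasi-isometric embedding if this holds for some such $\lambda,\epsilon$. *)

theory Defs
  imports "HOL-Algebra.Divisibility" "HOL-Algebra.Generated_Groups" "HOL-Algebra.Lattice" "HOL-Library.Extended_Nat"
begin

definition list_prod :: "('a, 'b) monoid_scheme \<Rightarrow> 'a list \<Rightarrow> 'a" where
  "list_prod M ws = foldr (\<lambda>x y. x \<otimes>\<^bsub>M\<^esub> y) ws \<one>\<^bsub>M\<^esub>"

definition monoid_generated_by :: "('a, 'b) monoid_scheme \<Rightarrow> 'a set \<Rightarrow> bool" where
  "monoid_generated_by M S \<longleftrightarrow>
     S \<subseteq> carrier M \<and> (\<forall>a \<in> carrier M. \<exists>ws. set ws \<subseteq> S \<and> list_prod M ws = a)"

definition atoms :: "('a, 'b) monoid_scheme \<Rightarrow> 'a set" where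
  "atoms M = {a \<in> carrier M - {\<one>\<^bsub>M\<^esub>}.
     \<forall>b \<in> carrier M. \<forall>c \<in> carrier M. a = b \<otimes>\<^bsub>M\<^esub> c \<longrightarrow> b = \<one>\<^bsub>M\<^esub> \<or> c = \<one>\<^bsub>M\<^esub>}"

definition max_atom_length :: "('a, 'b) monoid_scheme \<Rightarrow> 'a \<Rightarrow> enat" where
  "max_atom_length M a = Sup {enat (length ws) | ws. set ws \<subseteq> atoms M \<and> list_prod M ws = a}"

locale atomic_monoid = monoid M for M (structure) +
  assumes atoms_generate: "monoid_generated_by M (atoms M)"
    and max_atom_length_finite: "a \<in> carrier M \<Longrightarrow> max_atom_length M a < \<infinity>"

definition left_le :: "('a, 'b) monoid_scheme \<Rightarrow> 'a \<Rightarrow> 'a \<Rightarrow> bool" where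
  "left_le M a b \<longleftrightarrow> (\<exists>c \<in> carrier M. a \<otimes>\<^bsub>M\<^esub> c = b)"

definition right_le :: "('a, 'b) monoid_scheme \<Rightarrow> 'a \<Rightarrow> 'a \<Rightarrow> bool" where
  "right_le M a b \<longleftrightarrow> (\<exists>c \<in> carrier M. c \<otimes>\<^bsub>M\<^esub> a = b)"

definition garside_element :: "('a, 'b) monoid_scheme \<Rightarrow> 'a \<Rightarrow> bool" where
  "garside_element M \<Delta> \<longleftrightarrow> \<Delta> \<in> carrier M
     \<and> (\<forall>a \<in> carrier M. left_le M a \<Delta> \<longleftrightarrow> right_le M a \<Delta>)
     \<and> monoid_generated_by M {a \<in> carrier M. left_le M a \<Delta>}"

locale garside_monoid = atomic_monoid M + monoid_cancel M for M (structure) +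
  assumes finitely_generated: "\<exists>S. finite S \<and> monoid_generated_by M S"
    and left_lattice: "lattice \<lparr>carrier = carrier M, eq = (=), le = left_le M\<rparr>"
    and right_lattice: "lattice \<lparr>carrier = carrier M, eq = (=), le = right_le M\<rparr>"
    and garside_element_exists: "\<exists>\<Delta>. garside_element M \<Delta>"

text \<open>
  \<open>G\<close> is the group of fractions of \<open>M\<close>, with \<open>\<iota>\<close> as the canonical embedding. For a cancellative
  monoid in which any two elements have a common left multiple (such as a Garside monoid) these
  conditions determine the pair \<open>(G, \<iota>)\<close> up to unique isomorphism (Ore). If common right
  multiples exist as well, left fractions and right fractions give the same notion.
\<close>
definition group_of_fractions ::
  "('a, 'b) monoid_scheme \<Rightarrow> ('c, 'd) monoid_scheme \<Rightarrow> ('a \<Rightarrow> 'c) \<Rightarrow> bool" where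
  "group_of_fractions M G \<iota> \<longleftrightarrow> group G \<and> \<iota> \<in> mon M G
     \<and> carrier G = {inv\<^bsub>G\<^esub> (\<iota> a) \<otimes>\<^bsub>G\<^esub> \<iota> b | a b. a \<in> carrier M \<and> b \<in> carrier M}"

definition finite_generating_set :: "('a, 'b) monoid_scheme \<Rightarrow> 'a set \<Rightarrow> bool" where
  "finite_generating_set G S \<longleftrightarrow> finite S \<and> S \<subseteq> carrier G \<and> generate G S = carrier G"

definition word_length :: "('a, 'b) monoid_scheme \<Rightarrow> 'a set \<Rightarrow> 'a \<Rightarrow> nat" where
  "word_length G S g =
     (LEAST n. \<exists>ws. length ws = n \<and> set ws \<subseteq> S \<union> m_inv G ` S \<and> list_prod G ws = g)"

definition word_dist :: "('a, 'b) monoid_scheme \<Rightarrow> 'a set \<Rightarrow> 'a \<Rightarrow> 'a \<Rightarrow> real" where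
  "word_dist G S g h = real (word_length G S (inv\<^bsub>G\<^esub> g \<otimes>\<^bsub>G\<^esub> h))"

definition quasi_isometric_embedding_with ::
  "real \<Rightarrow> real \<Rightarrow> 'a set \<Rightarrow> ('a \<Rightarrow> 'a \<Rightarrow> real) \<Rightarrow> 'b set \<Rightarrow> ('b \<Rightarrow> 'b \<Rightarrow> real) \<Rightarrow> ('a \<Rightarrow> 'b) \<Rightarrow> bool"
  where
  "quasi_isometric_embedding_with l e P dP Q dQ f \<longleftrightarrow> f \<in> P \<rightarrow> Q \<and>
     (\<forall>x \<in> P. \<forall>y \<in> P. 1 / l * dP x y - e \<le> dQ (f x) (f y)
                      \<and> dQ (f x) (f y) \<le> l * dP x y + e)"

definition quasi_isometric_embedding ::
  "'a set \<Rightarrow> ('a \<Rightarrow> 'a \<Rightarrow> real) \<Rightarrow> 'b set \<Rightarrow> ('b \<Rightarrow> 'b \<Rightarrow> real) \<Rightarrow> ('a \<Rightarrow> 'b) \<Rightarrow> bool" where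
  "quasi_isometric_embedding P dP Q dQ f \<longleftrightarrow>
     (\<exists>l e. l \<ge> 1 \<and> e \<ge> 0 \<and> quasi_isometric_embedding_with l e P dP Q dQ f)"

end

(*
The positive monoid P of a Garside group G is a cone with finite intervals and joins, and a power z
of the Garside element is central. If the powers of h grow slowly, then h^i z^f(i) is bounded below
for a function f of small slope, so these elements have a meet s in the lattice G. Shifting the
index changes f by at most 1 over a long range of i, hence the conjugates s^-1 h^i s all lie between
z^-1 and z for this range. This interval is finite, so two of them coincide and h is torsion.
Thus the word lengths of the powers of every element of infinite order grow at a uniform linear
rate, and Dirichlet's approximation theorem turns this rate into a linear lower bound on any
finitely generated abelian group.
*)
theory Submission
  imports Defs "HOL-Algebra.FiniteProduct" "HOL-Analysis.Kronecker_Approximation_Theorem"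
begin

section \<open>Words and word lengths\<close>

text \<open>Linear growth on every cyclic subgroup does not by itself give a linear lower bound on
  Z^2. The length |x - \<theta> y| with irrational \<theta> grows linearly along each nonzero
  integer vector, yet integer vectors of arbitrarily large norm have arbitrarily small length: the
  rates are positive but have infimum zero. So the rate must not depend on the element. Here it is
  fixed by the number of elements of one interval and by the generators of G, and Dirichlet
  approximation is the device that excludes thin neighbourhoods of irrational directions. Torsion in
  the abelian group needs a separate argument, since the growth bound says nothing about elements of
  finite order.

  The other delicate point is the meet. It is taken over an infinite family and has to be compared
  with lower bounds that need not be positive. Finite intervals give its existence among positive
  elements, and central powers of z move any lower bound into the cone.\<close>

lemma list_prod_simps [simp]:
  "list_prod M [] = \<one>\<^bsub>M\<^esub>" "list_prod M (x # xs) = x \<otimes>\<^bsub>M\<^esub> list_prod M xs"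
  by (simp_all add: list_prod_def)

context monoid
begin

lemma list_prod_closed [simp]: "set ws \<subseteq> carrier G \<Longrightarrow> list_prod G ws \<in> carrier G"
  by (induction ws) auto

lemma list_prod_append:
  "\<lbrakk>set us \<subseteq> carrier G; set vs \<subseteq> carrier G\<rbrakk> \<Longrightarrow>
    list_prod G (us @ vs) = list_prod G us \<otimes> list_prod G vs"
  by (induction us) (simp_all add: m_assoc)

text \<open>If the first factor is trivial, the atom is the product of the others; otherwise the
  others multiply to one and the atom is the first factor.\<close>

lemma atom_in_factors:
  assumes "set ws \<subseteq> carrier G" "list_prod G ws \<in> atoms G"
  shows "list_prod G ws \<in> set ws"
  using assms
proof (induction ws)
  case (Cons x ws)
  then have "x = \<one> \<or> list_prod G ws = \<one>"
    by (auto simp: atoms_def)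
  then show ?case
    using Cons by auto
qed (simp add: atoms_def)

end

context group
begin

lemma symmetric_generators_closed:
  "S \<subseteq> carrier G \<Longrightarrow> S \<union> m_inv G ` S \<subseteq> carrier G"
  by auto

lemma generate_word:
  assumes "S \<subseteq> carrier G" "g \<in> generate G S"
  shows "\<exists>ws. set ws \<subseteq> S \<union> m_inv G ` S \<and> list_prod G ws = g"
  using assms(2)
proof (induction rule: generate.induct)
  case one
  show ?case
    by (intro exI[of _ "[]"]) simp
next
  case (incl h)
  then show ?case
    using assms(1) by (intro exI[of _ "[h]"]) auto
next
  case (inv h)
  then show ?case
    using assms(1) by (intro exI[of _ "[inv h]"]) auto
next
  case (eng g h)
  then obtain us vs where "set us \<subseteq> S \<union> m_inv G ` S" "list_prod G us = g"
    "set vs \<subseteq> S \<union> m_inv G ` S" "list_prod G vs = h"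
    by auto
  then show ?case
    using symmetric_generators_closed[OF assms(1)] list_prod_append[of us vs]
    by (intro exI[of _ "us @ vs"]) auto
qed

lemma word_length_le:
  assumes "set ws \<subseteq> S \<union> m_inv G ` S"
  shows "word_length G S (list_prod G ws) \<le> length ws"
  unfolding word_length_def using assms by (intro Least_le) blast

lemma word_length_witness:
  assumes "finite_generating_set G S" "g \<in> carrier G"
  obtains ws where "length ws = word_length G S g" "set ws \<subseteq> S \<union> m_inv G ` S" "list_prod G ws = g"
proof -
  have "\<exists>ws. set ws \<subseteq> S \<union> m_inv G ` S \<and> list_prod G ws = g"
    using assms by (intro generate_word) (auto simp: finite_generating_set_def)
  then have "\<exists>n ws. length ws = n \<and> set ws \<subseteq> S \<union> m_inv G ` S \<and> list_prod G ws = g"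
    by blast
  then have "\<exists>ws. length ws = word_length G S g \<and> set ws \<subseteq> S \<union> m_inv G ` S \<and> list_prod G ws = g"
    unfolding word_length_def by (rule LeastI_ex)
  then show ?thesis
    using that by blast
qed

lemma word_length_one: "word_length G S \<one> = 0"
  using word_length_le[of "[]" S] by simp

lemma word_length_mult:
  assumes S: "finite_generating_set G S" and "g \<in> carrier G" "h \<in> carrier G"
  shows "word_length G S (g \<otimes> h) \<le> word_length G S g + word_length G S h"
proof -
  obtain us vs where us: "length us = word_length G S g" "set us \<subseteq> S \<union> m_inv G ` S" "list_prod G us = g"
    and vs: "length vs = word_length G S h" "set vs \<subseteq> S \<union> m_inv G ` S" "list_prod G vs = h"
    using word_length_witness[OF S] assms(2,3) by metis
  moreover have "S \<union> m_inv G ` S \<subseteq> carrier G"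
    using S by (intro symmetric_generators_closed) (simp add: finite_generating_set_def)
  ultimately have "list_prod G (us @ vs) = g \<otimes> h"
    using list_prod_append[of us vs] by auto
  then show ?thesis
    using word_length_le[of "us @ vs" S] us vs by simp
qed

lemma word_length_int_pow:
  assumes S: "finite_generating_set G S" and x: "x \<in> S"
  shows "word_length G S (x [^] (k::int)) \<le> nat \<bar>k\<bar>"
proof -
  have nat_pow: "word_length G S (y [^] n) \<le> n" if y: "y \<in> S \<union> m_inv G ` S" for y and n :: nat
  proof -
    have yc: "y \<in> carrier G"
      using y S by (auto simp: finite_generating_set_def)
    have "list_prod G (replicate n y) = y [^] n"
    proof (induction n)
      case (Suc n)
      then show ?case
        using nat_pow_Suc2[OF yc, of n] by simp
    qed simp
    then show ?thesis
      using word_length_le[of "replicate n y" S] y set_replicate_conv_if[of n y] by simp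
  qed
  have xc: "x \<in> carrier G"
    using x S by (auto simp: finite_generating_set_def)
  show ?thesis
  proof (cases "k \<ge> 0")
    case True
    then show ?thesis
      using nat_pow[of x "nat k"] x by simp
  next
    case False
    then have "x [^] k = inv x [^] nat (- k)"
      using xc by (simp add: int_pow_inv int_pow_neg)
    then show ?thesis
      using nat_pow[of "inv x" "nat (- k)"] x False by simp
  qed
qed

lemma subadditive_le_word_length:
  fixes L :: "'a \<Rightarrow> real"
  assumes S: "finite_generating_set G S" and g: "g \<in> carrier G"
    and L_one: "L \<one> = 0"
    and L_mult: "\<And>x y. \<lbrakk>x \<in> carrier G; y \<in> carrier G\<rbrakk> \<Longrightarrow> L (x \<otimes> y) \<le> L x + L y"
    and C: "\<And>x. x \<in> S \<union> m_inv G ` S \<Longrightarrow> L x \<le> C"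
  shows "L g \<le> C * word_length G S g"
proof -
  obtain ws where ws: "length ws = word_length G S g" "set ws \<subseteq> S \<union> m_inv G ` S" "list_prod G ws = g"
    using word_length_witness[OF S g] by blast
  have sub: "S \<union> m_inv G ` S \<subseteq> carrier G"
    using S by (intro symmetric_generators_closed) (simp add: finite_generating_set_def)
  have "L (list_prod G ws) \<le> C * length ws"
    using ws(2)
  proof (induction ws)
    case (Cons x ws)
    have x: "x \<in> S \<union> m_inv G ` S" and ws: "set ws \<subseteq> S \<union> m_inv G ` S"
      using Cons.prems by auto
    have "L (x \<otimes> list_prod G ws) \<le> L x + L (list_prod G ws)"
      using x ws sub by (intro L_mult list_prod_closed) blast+
    then show ?case
      using Cons.IH[OF ws] C[OF x] by (simp add: algebra_simps)
  qed (simp add: L_one)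
  then show ?thesis
    using ws by simp
qed

lemma subadditive_linear_bound:
  fixes L :: "'a \<Rightarrow> real"
  assumes S: "finite_generating_set G S"
    and L_one: "L \<one> = 0"
    and L_nonneg: "\<And>x. x \<in> carrier G \<Longrightarrow> L x \<ge> 0"
    and L_mult: "\<And>x y. \<lbrakk>x \<in> carrier G; y \<in> carrier G\<rbrakk> \<Longrightarrow> L (x \<otimes> y) \<le> L x + L y"
  shows "\<exists>C\<ge>0::real. \<forall>g\<in>carrier G. L g \<le> C * word_length G S g"
proof -
  let ?X = "S \<union> m_inv G ` S"
  have X: "finite ?X" "?X \<subseteq> carrier G"
    using S by (auto simp: finite_generating_set_def)
  \<comment> \<open>By nonnegativity the sum dominates each term, and it is zero when there are no
    generators.\<close>
  define C where "C = sum L ?X"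
  have "L x \<le> C" if "x \<in> ?X" for x
    unfolding C_def using X L_nonneg that by (intro member_le_sum) auto
  moreover have "C \<ge> 0"
    unfolding C_def using X L_nonneg by (intro sum_nonneg) auto
  ultimately show ?thesis
    using subadditive_le_word_length[where L = L and C = C, OF S _ L_one L_mult] by auto
qed

end

section \<open>Length functions on finitely generated abelian groups\<close>

context comm_group
begin

text \<open>For finite \<open>S\<close> this is the homomorphism from Z^S to the group that sends
  each basis vector to its generator. If \<open>S\<close> generates, the word length of an element
  is the least l1 norm of an exponent vector in its fibre: \<open>word_length_combination\<close>
  gives one inequality, \<open>combination_of_word\<close> the other.\<close>

definition combination :: "'a set \<Rightarrow> ('a \<Rightarrow> int) \<Rightarrow> 'a" where
  "combination S f = finprod G (\<lambda>x. x [^] f x) S"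

lemma combination_closed [simp]: "S \<subseteq> carrier G \<Longrightarrow> combination S f \<in> carrier G"
  unfolding combination_def by (intro finprod_closed) auto

lemma combination_cong: "(\<And>x. x \<in> S \<Longrightarrow> f x = g x) \<Longrightarrow> S \<subseteq> carrier G \<Longrightarrow> combination S f = combination S g"
  unfolding combination_def by (intro finprod_cong') auto

lemma combination_add:
  assumes "S \<subseteq> carrier G"
  shows "combination S (\<lambda>x. f x + g x) = combination S f \<otimes> combination S g"
proof -
  have "combination S (\<lambda>x. f x + g x) = finprod G (\<lambda>x. x [^] f x \<otimes> x [^] g x) S"
    unfolding combination_def by (intro finprod_cong') (use assms in \<open>auto simp: int_pow_mult\<close>)
  also have "\<dots> = combination S f \<otimes> combination S g"
    unfolding combination_def by (intro finprod_multf) (use assms in auto)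
  finally show ?thesis .
qed

lemma combination_zero: "combination S (\<lambda>x. 0) = \<one>"
  by (simp add: combination_def)

lemma combination_smult_nat:
  assumes "S \<subseteq> carrier G"
  shows "combination S (\<lambda>x. int n * f x) = combination S f [^] n"
proof (induction n)
  case (Suc n)
  have "combination S (\<lambda>x. int (Suc n) * f x) = combination S (\<lambda>x. int n * f x + f x)"
    by (simp add: algebra_simps)
  then show ?case
    using Suc by (simp add: combination_add assms)
qed (simp add: combination_zero)

lemma combination_single:
  assumes "finite S" "S \<subseteq> carrier G" "x \<in> S"
  shows "combination S (\<lambda>y. if y = x then k else 0) = x [^] k"
proof -
  have "combination S (\<lambda>y. if y = x then k else 0) = finprod G (\<lambda>y. if y = x then y [^] k else \<one>) S"
    unfolding combination_def by (intro finprod_cong') (use assms in auto)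
  also have "\<dots> = x [^] k"
    by (rule finprod_singleton_swap) (use assms in auto)
  finally show ?thesis .
qed

lemma word_length_combination:
  assumes S: "finite_generating_set G S"
  shows "real (word_length G S (combination S f)) \<le> (\<Sum>x\<in>S. \<bar>real_of_int (f x)\<bar>)"
proof -
  have fin: "finite S" and sub: "S \<subseteq> carrier G"
    using S by (auto simp: finite_generating_set_def)
  have "real (word_length G S (combination F f)) \<le> (\<Sum>x\<in>F. \<bar>real_of_int (f x)\<bar>)" if "F \<subseteq> S" for F
    using finite_subset[OF that fin] that
  proof (induction F rule: finite_induct)
    case empty
    then show ?case
      by (simp add: combination_def word_length_one)
  next
    case (insert x F)
    have x: "x \<in> S" "x \<in> carrier G" and F: "F \<subseteq> S" "F \<subseteq> carrier G"
      using insert.prems sub by auto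
    have "combination (insert x F) f = x [^] f x \<otimes> combination F f"
      unfolding combination_def using insert.hyps x F by (intro finprod_insert) auto
    then have "word_length G S (combination (insert x F) f)
        \<le> word_length G S (x [^] f x) + word_length G S (combination F f)"
      using word_length_mult[OF S, of "x [^] f x" "combination F f"] x F by simp
    moreover have "real (word_length G S (x [^] f x)) \<le> \<bar>real_of_int (f x)\<bar>"
      using word_length_int_pow[OF S x(1), of "f x"] by linarith
    ultimately show ?case
      using insert.IH[OF F(1)] insert.hyps by simp
  qed
  then show ?thesis
    by blast
qed

text \<open>By commutativity the letters of a word can be collected. Each letter changes one
  exponent by 1, and cancellation can only lower the norm.\<close>

lemma combination_of_word:
  assumes S: "finite S" "S \<subseteq> carrier G"
  shows "set ws \<subseteq> S \<union> m_inv G ` S \<Longrightarrow>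
    \<exists>f. combination S f = list_prod G ws \<and> (\<Sum>x\<in>S. \<bar>real_of_int (f x)\<bar>) \<le> length ws"
proof (induction ws)
  case Nil
  then show ?case
    by (intro exI[of _ "\<lambda>x. 0"]) (simp add: combination_zero)
next
  case (Cons y ws)
  then obtain f where f: "combination S f = list_prod G ws" "(\<Sum>x\<in>S. \<bar>real_of_int (f x)\<bar>) \<le> length ws"
    by auto
  obtain x k where x: "x \<in> S" "y = x [^] (k::int)" "\<bar>k\<bar> = 1"
  proof -
    consider "y \<in> S" | x where "x \<in> S" "y = inv x"
      using Cons.prems by auto
    then show ?thesis
    proof cases
      case 1
      then show ?thesis
        using that[of y 1] S by auto
    next
      case (2 x)
      then show ?thesis
        using that[of x "-1"] S by (auto simp: int_pow_neg)
    qed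
  qed
  define g where "g z = (if z = x then k else 0) + f z" for z
  have "combination S g = list_prod G (y # ws)"
    unfolding g_def using S x f by (simp add: combination_add combination_single)
  moreover have "(\<Sum>z\<in>S. \<bar>real_of_int (g z)\<bar>) \<le> (\<Sum>z\<in>S. (if z = x then 1 else 0) + \<bar>real_of_int (f z)\<bar>)"
    by (rule sum_mono) (use x(3) in \<open>auto simp: g_def\<close>)
  moreover have "\<dots> = 1 + (\<Sum>z\<in>S. \<bar>real_of_int (f z)\<bar>)"
    using S x by (simp add: sum.distrib)
  ultimately show ?case
    using f(2) by (intro exI[of _ g]) simp
qed

end

text \<open>The simultaneous approximation theorem, reindexed along a bijection from
  \<open>S\<close> to an initial segment. One denominator serves all coordinates, and its bound is
  independent of \<open>\<theta>\<close>; this later confines the numerators to a finite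
  set.\<close>

lemma Dirichlet_approx_finite:
  fixes \<theta> :: "'b \<Rightarrow> real"
  assumes "finite S" "N > 0"
  obtains q :: nat and p :: "'b \<Rightarrow> int" where "0 < q" "q \<le> N ^ card S"
    "\<And>x. x \<in> S \<Longrightarrow> \<bar>q * \<theta> x - p x\<bar> < 1 / real N"
proof -
  obtain h where h: "bij_betw h S {0..<card S}"
    using ex_bij_betw_finite_nat[OF assms(1)] by blast
  obtain q p where qp: "0 < q" "q \<le> int (N ^ card S)"
    "\<And>i. i < card S \<Longrightarrow> \<bar>of_int q * \<theta> (inv_into S h i) - of_int (p i)\<bar> < 1 / N"
    using Dirichlet_approx_simult[OF assms(2), of "card S" "\<lambda>i. \<theta> (inv_into S h i)"] by blast
  show ?thesis
  proof (rule that[of "nat q" "\<lambda>x. p (h x)"])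
    show "\<bar>real (nat q) * \<theta> x - real_of_int (p (h x))\<bar> < 1 / real N" if "x \<in> S" for x
    proof -
      have "h x < card S" "inv_into S h (h x) = x"
        using h that by (auto dest: bij_betwE simp: bij_betw_def)
      then show ?thesis
        using qp(3)[of "h x"] qp(1) by simp
    qed
  qed (use qp in \<open>auto simp: nat_le_iff\<close>)
qed

section \<open>From the growth of powers to a linear lower bound\<close>

context comm_group
begin

text \<open>
  Approximate the exponent vector of a geodesic word for \<open>a\<close>, scaled by \<open>1 / R\<close> with \<open>R\<close> the length
  of the word, by \<open>p / q\<close>. If \<open>p\<close> represents an element of infinite order, then its power growth
  forces \<open>L a\<close> to be proportional to \<open>R\<close>. Otherwise a multiple of \<open>p\<close> is a relation,
  which would shorten the word if \<open>R\<close> were large.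
\<close>
lemma linear_lower_bound:
  fixes L :: "'a \<Rightarrow> real"
  assumes S: "finite_generating_set G S"
    and L_one: "L \<one> = 0"
    and L_nonneg: "\<And>x. x \<in> carrier G \<Longrightarrow> L x \<ge> 0"
    and L_mult: "\<And>x y. \<lbrakk>x \<in> carrier G; y \<in> carrier G\<rbrakk> \<Longrightarrow> L (x \<otimes> y) \<le> L x + L y"
    and c: "c > 0"
    and growth: "\<And>a n. \<lbrakk>a \<in> carrier G; \<forall>d>0. a [^] (d::nat) \<noteq> \<one>; n > 0\<rbrakk> \<Longrightarrow> c * real n \<le> L (a [^] (n::nat))"
  shows "\<exists>\<kappa>>0::real. \<exists>B\<ge>0::real. \<forall>a\<in>carrier G. \<kappa> * word_length G S a - B \<le> L a"
proof -
  have fin: "finite S" and sub: "S \<subseteq> carrier G"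
    using S by (auto simp: finite_generating_set_def)
  obtain C :: real where C: "C \<ge> 0" "\<And>g. g \<in> carrier G \<Longrightarrow> L g \<le> C * word_length G S g"
    using subadditive_linear_bound[where L = L, OF S L_one L_nonneg L_mult] by blast
  have L_pow: "L (a [^] n) \<le> n * L a" if "a \<in> carrier G" for a and n :: nat
  proof (induction n)
    case (Suc n)
    then show ?case
      using L_mult[of "a [^] n" a] that by (simp add: algebra_simps)
  qed (simp add: L_one)
  define n where "n = card S"
  \<comment> \<open>The two summands serve the two cases below: with N at least 2nC/c the
    approximation error costs at most half of the growth \<open>c * R\<close>, and with N at least
    2n it costs at most half of \<open>R\<close> itself.\<close>
  obtain N0 :: nat where N0: "2 * real n * C / c + 2 * real n \<le> real N0"
    using real_arch_simple by blast
  define N where "N = Suc N0"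
  have N: "N > 0" "2 * real n * C \<le> c * N" "2 * real n \<le> N"
  proof -
    have "0 \<le> 2 * real n * C / c"
      using C c by simp
    then have *: "2 * real n * C / c \<le> N" "2 * real n \<le> N"
      using N0 by (auto simp: N_def)
    then show "2 * real n * C \<le> c * N" "2 * real n \<le> N"
      using c by (simp_all add: pos_divide_le_eq mult.commute)
  qed (simp add: N_def)
  define Q where "Q = N ^ n"
  have Q: "Q > 0"
    using N by (simp add: Q_def)
  \<comment> \<open>\<open>V\<close> contains every element that an approximating numerator vector
    can represent, whatever \<open>a\<close> is, because such numerators are at most Q + 1 in
    absolute value. Its torsion part \<open>W\<close> is finite, so \<open>T\<close> bounds all the
    chosen annihilating exponents at once.\<close>
  define V where "V = combination S ` (S \<rightarrow>\<^sub>E {- int (Suc Q)..int (Suc Q)})"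
  define W where "W = {b \<in> V. \<exists>d>0. b [^] (d::nat) = \<one>}"
  have finW: "finite W"
    unfolding W_def V_def using fin by (intro finite_Collect_conjI disjI1) (simp add: finite_PiE)
  obtain t :: "'a \<Rightarrow> nat" where t: "\<And>b. b \<in> W \<Longrightarrow> t b > 0 \<and> b [^] t b = \<one>"
    using that bchoice[of W "\<lambda>b d. d > (0::nat) \<and> b [^] d = \<one>"] by (auto simp: W_def)
  define T where "T = sum t W"
  \<comment> \<open>\<open>\<kappa>\<close> is read off from c R / 2 \<le> Q L(a) in the growth
    case, and \<open>R0\<close> from R \<le> R / 2 + R0 / 2 in the torsion case.\<close>
  define \<kappa> where "\<kappa> = c / (2 * Q)"
  define R0 where "R0 = 2 * n * T * real (Suc Q)"
  have \<kappa>: "\<kappa> > 0" and R0: "R0 \<ge> 0"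
    using c Q by (auto simp: \<kappa>_def R0_def)
  have "\<kappa> * word_length G S a - \<kappa> * R0 \<le> L a" if a: "a \<in> carrier G" for a
  proof -
    define R where "R = word_length G S a"
    obtain ws where ws: "length ws = R" "set ws \<subseteq> S \<union> m_inv G ` S" "list_prod G ws = a"
      using word_length_witness[OF S a] by (auto simp: R_def)
    obtain f where f: "combination S f = a" "(\<Sum>x\<in>S. \<bar>real_of_int (f x)\<bar>) \<le> R"
      using combination_of_word[OF fin sub ws(2)] ws by auto
    have "R \<le> R0 \<or> \<kappa> * R \<le> L a"
    proof (cases "R = 0")
      case True
      then show ?thesis
        using R0 by simp
    next
      case False
      obtain q p where q: "0 < q" "q \<le> Q"
        and p: "\<And>x. x \<in> S \<Longrightarrow> \<bar>q * (f x / R) - real_of_int (p x)\<bar> < 1 / N"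
        using Dirichlet_approx_finite[OF fin N(1), of "\<lambda>x. f x / R"] unfolding n_def[symmetric] Q_def by blast
      \<comment> \<open>The error of the approximation after clearing denominators. In the group it
        says that a^q is b^R times the element with exponent vector \<open>E\<close>, where
        \<open>b\<close> has exponent vector \<open>p\<close>.\<close>
      define E where "E x = int q * f x - int R * p x" for x
      have E: "\<bar>real_of_int (E x)\<bar> \<le> R / N" if "x \<in> S" for x
      proof -
        have "real_of_int (E x) = R * (q * (f x / R) - p x)"
          using False by (simp add: E_def field_simps)
        then have "\<bar>real_of_int (E x)\<bar> = R * \<bar>q * (f x / R) - p x\<bar>"
          by (simp add: abs_mult)
        also have "\<dots> \<le> R * (1 / N)"
          using p[OF that] by (intro mult_left_mono) auto
        finally show ?thesis
          by simp
      qed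
      have p_le: "\<bar>p x\<bar> \<le> int (Suc Q)" if "x \<in> S" for x
      proof -
        have "\<bar>real_of_int (f x)\<bar> \<le> (\<Sum>x\<in>S. \<bar>real_of_int (f x)\<bar>)"
          using fin that by (intro member_le_sum) auto
        then have "\<bar>f x / R\<bar> \<le> 1"
          using f(2) False by (simp add: abs_divide)
        then have "\<bar>q * (f x / R)\<bar> \<le> q"
          using mult_left_mono[of "\<bar>f x / R\<bar>" 1 "real q"] by (simp add: abs_mult)
        moreover have "1 / real N \<le> 1"
          using N by simp
        ultimately have "\<bar>real_of_int (p x)\<bar> \<le> q + 1"
          using p[OF that] by linarith
        then show ?thesis
          using q(2) by linarith
      qed
      define b where "b = combination S p"
      have b: "b \<in> carrier G"
        using sub by (simp add: b_def)
      show ?thesis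
      proof (cases "\<exists>d>0. b [^] (d::nat) = \<one>")
        case False
        have "b [^] R = combination S (\<lambda>x. int q * f x + - E x)"
          unfolding b_def E_def by (simp add: combination_smult_nat[symmetric] sub)
        also have "\<dots> = a [^] q \<otimes> combination S (\<lambda>x. - E x)"
          using sub f(1) combination_add[of S "\<lambda>x. int q * f x" "\<lambda>x. - E x"]
          by (simp add: combination_smult_nat)
        finally have "L (b [^] R) \<le> L (a [^] q) + L (combination S (\<lambda>x. - E x))"
          using L_mult a sub by simp
        moreover have "c * R \<le> L (b [^] R)"
          using growth[OF b] False \<open>R \<noteq> 0\<close> by blast
        moreover have "L (a [^] q) \<le> Q * L a"
          using L_pow[OF a, of q] mult_right_mono[of "real q" "real Q" "L a"] q L_nonneg[OF a] by linarith
        moreover have "L (combination S (\<lambda>x. - E x)) \<le> c * R / 2"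
        proof -
          have "real (word_length G S (combination S (\<lambda>x. - E x))) \<le> (\<Sum>x\<in>S. \<bar>real_of_int (- E x)\<bar>)"
            by (rule word_length_combination[OF S])
          also have "\<dots> \<le> (\<Sum>x\<in>S. R / N)"
            using E by (intro sum_mono) simp
          also have "\<dots> = n * (R / N)"
            by (simp add: n_def)
          finally have "C * word_length G S (combination S (\<lambda>x. - E x)) \<le> C * (n * (R / N))"
            using C(1) by (rule mult_left_mono)
          also have "\<dots> = (2 * real n * C) * (R / (2 * N))"
            by simp
          also have "\<dots> \<le> (c * N) * (R / (2 * N))"
            using N by (intro mult_right_mono) auto
          also have "\<dots> = c * R / 2"
            using N(1) by simp
          finally show ?thesis
            using C(2)[of "combination S (\<lambda>x. - E x)"] sub by simp
        qed
        ultimately have "c * R / 2 \<le> Q * L a"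
          by simp
        then have "\<kappa> * R \<le> L a"
          using Q by (simp add: \<kappa>_def field_simps)
        then show ?thesis ..
      next
        case True
        \<comment> \<open>Membership in \<open>V\<close> asks for an extensional function;
          \<open>combination\<close> does not see values outside \<open>S\<close>.\<close>
        have "b = combination S (restrict p S)"
          unfolding b_def using sub by (intro combination_cong) auto
        moreover have "restrict p S \<in> S \<rightarrow>\<^sub>E {- int (Suc Q)..int (Suc Q)}"
          using p_le by (force simp: abs_le_iff)
        ultimately have "b \<in> W"
          unfolding W_def V_def using True by blast
        then have tb: "t b > 0" "b [^] t b = \<one>" "t b \<le> T"
          using t finW by (auto simp: T_def intro: member_le_sum)
        \<comment> \<open>The vector \<open>t b\<close> times \<open>p\<close> is a relation. Since
          \<open>f\<close> is close to \<open>R / q\<close> times \<open>p\<close>, subtracting this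
          relation about \<open>R / (q * t b)\<close> times nearly cancels \<open>f\<close>.
          Rounding the multiplier down leaves q g = E + r p with r \<le> q t(b).\<close>
        define k where "k = R div (q * t b)"
        define r where "r = R mod (q * t b)"
        have R: "R = k * (q * t b) + r" and r: "r \<le> q * t b"
          using q tb by (simp_all only: k_def r_def div_mult_mod_eq) (simp add: less_imp_le)
        define g where "g x = f x - int (t b * k) * p x" for x
        have "combination S (\<lambda>x. int (t b * k) * p x) = \<one>"
          using tb b sub by (simp only: combination_smult_nat b_def[symmetric] nat_pow_pow[symmetric]) simp
        then have "combination S g = combination S (\<lambda>x. g x + int (t b * k) * p x)"
          using sub by (simp add: combination_add)
        also have "\<dots> = a"
          using f by (simp add: g_def)
        \<comment> \<open>The vector \<open>g\<close> still represents \<open>a\<close>, and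
          \<open>R\<close> is the word length of \<open>a\<close>, so its norm cannot be smaller
          than \<open>R\<close>.\<close>
        finally have "R \<le> (\<Sum>x\<in>S. \<bar>real_of_int (g x)\<bar>)"
          using word_length_combination[OF S, of g] by (simp add: R_def)
        also have "\<dots> \<le> (\<Sum>x\<in>S. R / N + T * real (Suc Q))"
        proof (rule sum_mono)
          fix x assume x: "x \<in> S"
          have "int q * g x = E x + int r * p x"
            by (simp add: g_def E_def R algebra_simps)
          then have "real q * \<bar>real_of_int (g x)\<bar> = \<bar>real_of_int (E x) + r * p x\<bar>"
            by (metis abs_mult abs_of_nat of_int_add of_int_mult of_int_of_nat_eq)
          also have "\<dots> \<le> \<bar>real_of_int (E x)\<bar> + r * \<bar>real_of_int (p x)\<bar>"
            using abs_triangle_ineq[of "real_of_int (E x)" "r * p x"] by (simp add: abs_mult)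
          also have "\<dots> \<le> q * (R / N) + (q * T) * real (Suc Q)"
          proof (rule add_mono)
            have "1 * (R / N) \<le> q * (R / N)"
              using q by (intro mult_right_mono) auto
            then show "\<bar>real_of_int (E x)\<bar> \<le> q * (R / N)"
              using E[OF x] by simp
            have "real r \<le> real (q * T)"
              using r tb(3) mult_le_mono2[of "t b" T q] by linarith
            moreover have "\<bar>real_of_int (p x)\<bar> \<le> real (Suc Q)"
              using p_le[OF x] by linarith
            ultimately show "r * \<bar>real_of_int (p x)\<bar> \<le> (q * T) * real (Suc Q)"
              by (intro mult_mono) auto
          qed
          also have "\<dots> = q * (R / N + T * real (Suc Q))"
            by (simp add: algebra_simps)
          finally show "\<bar>real_of_int (g x)\<bar> \<le> R / N + T * real (Suc Q)"
            using q(1) by (simp only: mult_le_cancel_left_pos of_nat_0_less_iff)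
        qed
        also have "\<dots> = n * (R / N) + R0 / 2"
          by (simp add: n_def R0_def algebra_simps)
        also have "n * (R / N) \<le> R / 2"
          using mult_right_mono[OF N(3), of "R / (2 * N)"] N(1) by simp
        finally have "R \<le> R0"
          by simp
        then show ?thesis ..
      qed
    qed
    then show ?thesis
    proof
      assume "R \<le> R0"
      then have "\<kappa> * R \<le> \<kappa> * R0"
        using \<kappa> by simp
      then show ?thesis
        using L_nonneg[OF a] by (simp add: R_def)
    next
      assume "\<kappa> * R \<le> L a"
      moreover have "\<kappa> * R0 \<ge> 0"
        using \<kappa> R0 by simp
      ultimately show ?thesis
        by (simp add: R_def)
    qed
  qed
  then show ?thesis
    using \<kappa> R0 by (intro exI[of _ \<kappa>] conjI exI[of _ "\<kappa> * R0"]) auto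
qed

end

section \<open>Groups with a lattice-ordered positive cone\<close>

text \<open>The model is the image \<open>P\<close> of a Garside monoid in its group of fractions,
  with \<open>z\<close> a central power of the Garside element. The relation inv x \<otimes> y \<in>
  P extends left divisibility to the group. By \<open>absorb\<close>, powers of \<open>z\<close> are
  cofinal for it; \<open>joins\<close> is stated inside \<open>P\<close>, where the lattice property
  of the monoid applies directly.\<close>

locale lattice_cone = group G for G (structure) +
  fixes P :: "'a set" and z :: 'a
  assumes P_subset: "P \<subseteq> carrier G"
    and one_in_P: "\<one> \<in> P"
    and mult_in_P: "\<lbrakk>x \<in> P; y \<in> P\<rbrakk> \<Longrightarrow> x \<otimes> y \<in> P"
    and z_in_P: "z \<in> P"
    and z_central: "x \<in> carrier G \<Longrightarrow> x \<otimes> z = z \<otimes> x"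
    and absorb: "x \<in> carrier G \<Longrightarrow> \<exists>k::nat. x \<otimes> z [^] k \<in> P"
    and finite_divisors: "u \<in> P \<Longrightarrow> finite {p \<in> P. inv p \<otimes> u \<in> P}"
    and joins: "\<lbrakk>a \<in> P; b \<in> P\<rbrakk> \<Longrightarrow> \<exists>c\<in>P. inv a \<otimes> c \<in> P \<and> inv b \<otimes> c \<in> P \<and>
      (\<forall>d\<in>P. inv a \<otimes> d \<in> P \<longrightarrow> inv b \<otimes> d \<in> P \<longrightarrow> inv c \<otimes> d \<in> P)"
begin

definition cone_le :: "'a \<Rightarrow> 'a \<Rightarrow> bool" (infix \<open>\<preceq>\<close> 50) where
  "x \<preceq> y \<longleftrightarrow> inv x \<otimes> y \<in> P"

lemma P_carrier [simp, dest]: "x \<in> P \<Longrightarrow> x \<in> carrier G"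
  using P_subset by blast

lemma z_carrier [simp]: "z \<in> carrier G"
  using z_in_P by simp

lemma inv_mult_cancel:
  assumes "x \<in> carrier G" "y \<in> carrier G"
  shows "inv x \<otimes> (x \<otimes> y) = y" "x \<otimes> (inv x \<otimes> y) = y"
  using assms by (simp_all flip: m_assoc)

lemma z_pow_in_P: "z [^] (k::nat) \<in> P"
  by (induction k) (auto simp: one_in_P mult_in_P z_in_P)

lemma z_pow_central: "x \<in> carrier G \<Longrightarrow> z [^] (k::nat) \<otimes> x = x \<otimes> z [^] k"
proof (induction k)
  case (Suc k)
  then show ?case
    by (metis m_assoc nat_pow_Suc nat_pow_closed z_carrier z_central)
qed simp

lemma z_pow_mono:
  assumes "x \<in> carrier G" "x \<otimes> z [^] k \<in> P" "k \<le> l"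
  shows "x \<otimes> z [^] (l::nat) \<in> P"
proof -
  have "x \<otimes> z [^] l = (x \<otimes> z [^] k) \<otimes> z [^] (l - k)"
    using assms by (simp add: m_assoc nat_pow_mult)
  then show ?thesis
    using assms z_pow_in_P mult_in_P by simp
qed

lemma mult_z_pow_in_P:
  assumes "x \<in> carrier G" "y \<in> carrier G" "x \<otimes> z [^] k \<in> P" "y \<otimes> z [^] l \<in> P"
  shows "(x \<otimes> y) \<otimes> z [^] (k + l :: nat) \<in> P"
proof -
  have "(x \<otimes> y) \<otimes> z [^] (k + l) = (x \<otimes> z [^] k) \<otimes> (y \<otimes> z [^] l)"
    using assms by (simp add: m_assoc flip: nat_pow_mult)
      (metis m_assoc nat_pow_closed z_carrier z_pow_central)
  then show ?thesis
    using assms mult_in_P by simp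
qed

lemma pow_z_pow_in_P:
  assumes "x \<in> carrier G" "x \<otimes> z [^] k \<in> P"
  shows "x [^] q \<otimes> z [^] (q * k :: nat) \<in> P"
proof (induction q)
  case (Suc q)
  then show ?case
    using mult_z_pow_in_P[OF _ _ Suc assms(2)] assms by (simp add: add.commute)
qed (simp add: one_in_P)

lemma absorb_uniform:
  assumes "finite F" "F \<subseteq> carrier G"
  shows "\<exists>k::nat. \<forall>x\<in>F. x \<otimes> z [^] k \<in> P"
  using assms
proof (induction F rule: finite_induct)
  case (insert x F)
  then obtain k where k: "\<forall>x\<in>F. x \<otimes> z [^] (k::nat) \<in> P"
    by auto
  obtain l where "x \<otimes> z [^] (l::nat) \<in> P"
    using absorb insert.prems by auto
  then show ?case
    using k insert.prems
    by (intro exI[of _ "k + l"]) (auto intro: z_pow_mono[of _ k "k + l"] z_pow_mono[of _ l "k + l"])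
qed simp

section \<open>The left-invariant order and its meets\<close>

lemma cone_le_trans:
  assumes "x \<in> carrier G" "y \<in> carrier G" "w \<in> carrier G" "x \<preceq> y" "y \<preceq> w"
  shows "x \<preceq> w"
proof -
  have "inv x \<otimes> w = (inv x \<otimes> y) \<otimes> (inv y \<otimes> w)"
    using assms(1-3) by (simp add: m_assoc inv_mult_cancel)
  then show ?thesis
    using assms(4,5) mult_in_P by (simp add: cone_le_def)
qed

lemma cone_le_translate:
  assumes "g \<in> carrier G" "x \<in> carrier G" "y \<in> carrier G"
  shows "g \<otimes> x \<preceq> g \<otimes> y \<longleftrightarrow> x \<preceq> y"
proof -
  have "inv (g \<otimes> x) \<otimes> (g \<otimes> y) = inv x \<otimes> y"
    using assms by (simp add: inv_mult_group m_assoc inv_mult_cancel)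
  then show ?thesis
    by (simp add: cone_le_def)
qed

text \<open>Although \<open>X\<close> may be infinite, its positive lower bounds all divide one
  element, so they are finitely many. Take one, \<open>s\<close>, with the most divisors. Its join
  with another lower bound \<open>y\<close> is again a lower bound and has at least the divisors of
  \<open>s\<close>; by maximality it has no others, so its divisor \<open>y\<close> divides
  \<open>s\<close>.\<close>

lemma cone_gcd:
  assumes "X \<subseteq> P" "X \<noteq> {}"
  shows "\<exists>s\<in>P. (\<forall>x\<in>X. s \<preceq> x) \<and> (\<forall>y\<in>P. (\<forall>x\<in>X. y \<preceq> x) \<longrightarrow> y \<preceq> s)"
proof -
  define CD where "CD = {p\<in>P. \<forall>x\<in>X. p \<preceq> x}"
  define Dv where "Dv u = {p \<in> P. p \<preceq> u}" for u
  obtain x0 where x0: "x0 \<in> X"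
    using assms by blast
  have fin: "finite (Dv u)" if "u \<in> P" for u
    using finite_divisors[OF that] by (simp add: Dv_def cone_le_def)
  have "finite CD"
    by (rule finite_subset[OF _ fin[of x0]]) (use x0 assms in \<open>auto simp: CD_def Dv_def\<close>)
  moreover have "\<one> \<in> CD"
    using assms by (auto simp: CD_def one_in_P cone_le_def)
  ultimately have "Max ((\<lambda>c. card (Dv c)) ` CD) \<in> (\<lambda>c. card (Dv c)) ` CD"
    by (intro Max_in) auto
  then obtain s where s: "s \<in> CD" and s_max: "card (Dv s) = Max ((\<lambda>c. card (Dv c)) ` CD)"
    by auto
  have max: "card (Dv c) \<le> card (Dv s)" if "c \<in> CD" for c
    using that \<open>finite CD\<close> by (simp add: s_max)
  have "y \<preceq> s" if y: "y \<in> P" "\<forall>x\<in>X. y \<preceq> x" for y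
  proof -
    obtain c where c: "c \<in> P" "s \<preceq> c" "y \<preceq> c" "\<forall>d\<in>P. s \<preceq> d \<longrightarrow> y \<preceq> d \<longrightarrow> c \<preceq> d"
      using joins[of s y] s y(1) by (auto simp: CD_def cone_le_def)
    then have "c \<in> CD"
      using s y assms(1) by (auto simp: CD_def)
    moreover have "Dv s \<subseteq> Dv c"
      using c s cone_le_trans by (auto simp: Dv_def CD_def)
    ultimately have "Dv s = Dv c"
      using max fin[OF c(1)] by (simp add: card_subset_eq card_mono le_antisym)
    moreover have "y \<in> Dv c"
      using y(1) c(3) by (simp add: Dv_def)
    ultimately show ?thesis
      by (auto simp: Dv_def)
  qed
  then show ?thesis
    using s by (auto simp: CD_def)
qed

text \<open>\<open>cone_gcd\<close> compares \<open>s\<close> with positive lower bounds only. To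
  reach an arbitrary lower bound \<open>y\<close>, multiply by a power \<open>Z\<close> of
  \<open>z\<close> that makes it positive, and let \<open>t\<close> be the gcd of the translated
  family. Since \<open>Z\<close> is itself a lower bound there, inv Z \<otimes> t is a positive
  lower bound of \<open>X\<close>, hence below \<open>s\<close>. Thus Z \<otimes> y \<preceq> t
  \<preceq> Z \<otimes> s, and \<open>Z\<close> cancels.\<close>

lemma cone_glb:
  assumes "X \<subseteq> P" "X \<noteq> {}"
  shows "\<exists>s\<in>P. (\<forall>x\<in>X. s \<preceq> x) \<and> (\<forall>y\<in>carrier G. (\<forall>x\<in>X. y \<preceq> x) \<longrightarrow> y \<preceq> s)"
proof -
  obtain s where s: "s \<in> P" "\<forall>x\<in>X. s \<preceq> x" "\<forall>y\<in>P. (\<forall>x\<in>X. y \<preceq> x) \<longrightarrow> y \<preceq> s"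
    using cone_gcd[OF assms] by blast
  have "y \<preceq> s" if y: "y \<in> carrier G" "\<forall>x\<in>X. y \<preceq> x" for y
  proof -
    obtain N where N: "y \<otimes> z [^] (N::nat) \<in> P"
      using absorb y(1) by blast
    define Z where "Z = z [^] N"
    have Z: "Z \<in> P" "Z \<in> carrier G" "\<And>x. x \<in> carrier G \<Longrightarrow> x \<otimes> Z = Z \<otimes> x"
      using z_pow_in_P z_pow_central by (auto simp: Z_def)
    have "(\<otimes>) Z ` X \<subseteq> P" "(\<otimes>) Z ` X \<noteq> {}"
      using assms Z(1) mult_in_P by auto
    then obtain t where t: "t \<in> P" "\<forall>x\<in>X. t \<preceq> Z \<otimes> x" "\<forall>y\<in>P. (\<forall>x\<in>X. y \<preceq> Z \<otimes> x) \<longrightarrow> y \<preceq> t"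
      using cone_gcd[of "(\<otimes>) Z ` X"] by auto
    have "\<forall>x\<in>X. Z \<preceq> Z \<otimes> x"
      using assms(1) Z(2) by (auto simp: cone_le_def simp flip: m_assoc)
    then have *: "inv Z \<otimes> t \<in> P"
      using t(3) Z(1) by (simp add: cone_le_def)
    have eq: "Z \<otimes> (inv Z \<otimes> t) = t"
      using t(1) Z(2) by (simp flip: m_assoc)
    have "\<forall>x\<in>X. inv Z \<otimes> t \<preceq> x"
      using t(2) eq cone_le_translate[OF Z(2), of "inv Z \<otimes> t"] * assms(1)
      by (metis P_carrier subsetD)
    then have "inv Z \<otimes> t \<preceq> s"
      using s(3) * by blast
    then have ts: "t \<preceq> Z \<otimes> s"
      using eq cone_le_translate[OF Z(2), of "inv Z \<otimes> t" s] * s(1) by auto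
    have "Z \<otimes> y \<in> P" "\<forall>x\<in>X. Z \<otimes> y \<preceq> Z \<otimes> x"
      using N y assms(1) Z by (auto simp flip: Z_def simp: cone_le_translate)
    then have "Z \<otimes> y \<preceq> Z \<otimes> s"
      using t(1,3) ts s(1) Z(2) by (meson P_carrier cone_le_trans m_closed)
    then show ?thesis
      using cone_le_translate Z(2) y(1) s(1) by simp
  qed
  then show ?thesis
    using s by blast
qed

text \<open>By centrality of \<open>z\<close> this is the interval from inv z to z, written in a
  form that is visibly symmetric under inversion.\<close>

definition "slab = {v \<in> carrier G. v \<otimes> z \<in> P \<and> inv v \<otimes> z \<in> P}"

text \<open>Multiplication by \<open>z\<close> moves the slab injectively into the set of divisors
  of z \<otimes> z.\<close>

lemma finite_slab: "finite slab"
proof -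
  define u where "u = z \<otimes> z"
  have u: "u \<in> P"
    using z_in_P mult_in_P by (simp add: u_def)
  have "(\<lambda>v. v \<otimes> z) ` slab \<subseteq> {p \<in> P. inv p \<otimes> u \<in> P}"
  proof clarsimp
    fix v assume v: "v \<in> slab"
    then have vc: "v \<in> carrier G"
      by (simp add: slab_def)
    have "v \<otimes> z = z \<otimes> v"
      using vc by (rule z_central)
    then have "inv (v \<otimes> z) \<otimes> u = inv v \<otimes> z"
      using vc by (simp add: u_def inv_mult_group m_assoc inv_mult_cancel)
    then show "v \<otimes> z \<in> P \<and> inv (v \<otimes> z) \<otimes> u \<in> P"
      using v by (simp add: slab_def)
  qed
  then have "finite ((\<lambda>v. v \<otimes> z) ` slab)"
    using finite_divisors[OF u] finite_subset by blast
  moreover have "inj_on (\<lambda>v. v \<otimes> z) slab"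
    by (rule inj_onI) (auto simp: slab_def)
  ultimately show ?thesis
    using finite_imageD by blast
qed

text \<open>A single slow power controls all powers. Write i = n q + r: each block h^n costs k
  powers of z, where k m \<le> n, and the remainders r < n cost a bounded amount. Negative exponents
  follow by the same argument for inv h.\<close>

lemma int_pow_slow_growth:
  assumes h: "h \<in> carrier G" and n: "n > 0" "k * m \<le> n" and m: "m > 0"
    and hk: "h [^] (n::nat) \<otimes> z [^] (k::nat) \<in> P" "inv (h [^] n) \<otimes> z [^] k \<in> P"
  shows "\<exists>C::nat. \<forall>i::int. h [^] i \<otimes> z [^] (nat \<bar>i\<bar> div m + C) \<in> P"
proof -
  have "\<exists>C::nat. \<forall>i::nat. g [^] i \<otimes> z [^] (i div m + C) \<in> P"
    if g: "g \<in> carrier G" and gk: "g [^] n \<otimes> z [^] k \<in> P" for g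
  proof -
    obtain C where C: "\<forall>x\<in>(\<lambda>r::nat. g [^] r) ` {..<n}. x \<otimes> z [^] (C::nat) \<in> P"
      using absorb_uniform[of "(\<lambda>r::nat. g [^] r) ` {..<n}"] g by auto
    have "g [^] i \<otimes> z [^] (i div m + C) \<in> P" for i :: nat
    proof -
      define q r where "q = i div n" and "r = i mod n"
      have i: "i = n * q + r" and r: "r < n"
        using n by (auto simp: q_def r_def)
      have "(g [^] n) [^] q \<otimes> z [^] (q * k) \<in> P"
        using pow_z_pow_in_P g gk by simp
      moreover have "g [^] r \<otimes> z [^] C \<in> P"
        using C r by auto
      ultimately have "((g [^] n) [^] q \<otimes> g [^] r) \<otimes> z [^] (q * k + C) \<in> P"
        using g by (intro mult_z_pow_in_P) auto
      moreover have "(g [^] n) [^] q \<otimes> g [^] r = g [^] i"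
        using g by (simp add: i nat_pow_pow nat_pow_mult)
      moreover have "q * k \<le> i div m"
      proof -
        have "q * k * m \<le> q * n"
          using n(2) by (simp add: mult.assoc)
        also have "\<dots> \<le> i"
          by (simp add: i mult.commute)
        finally show ?thesis
          using m by (simp add: less_eq_div_iff_mult_less_eq)
      qed
      ultimately show ?thesis
        using z_pow_mono[of "g [^] i" "q * k + C" "i div m + C"] g by simp
    qed
    then show ?thesis
      by blast
  qed
  note aux = this
  obtain C1 where C1: "\<forall>i::nat. h [^] i \<otimes> z [^] (i div m + C1) \<in> P"
    using aux h hk by blast
  obtain C2 where C2: "\<forall>i::nat. inv h [^] i \<otimes> z [^] (i div m + C2) \<in> P"
    using aux[of "inv h"] h hk by (auto simp: nat_pow_inv)
  have "h [^] i \<otimes> z [^] (nat \<bar>i\<bar> div m + (C1 + C2)) \<in> P" for i :: int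
  proof (cases "i \<ge> 0")
    case True
    then have "h [^] i = h [^] nat i"
      by (metis int_nat_eq int_pow_int)
    then show ?thesis
      using True C1[rule_format, of "nat i"] h z_pow_mono[of "h [^] nat i" "nat i div m + C1" "nat i div m + (C1 + C2)"] by simp
  next
    case False
    then have "h [^] i = inv h [^] nat (- i)"
      using h by (simp add: int_pow_inv int_pow_neg)
    then show ?thesis
      using False C2[rule_format, of "nat (- i)"] h
        z_pow_mono[of "inv h [^] nat (- i)" "nat (- i) div m + C2" "nat (- i) div m + (C1 + C2)"]
      by simp
  qed
  then show ?thesis
    by blast
qed

text \<open>Left multiplication by h^j permutes the family \<open>x\<close> up to a factor z as long
  as |j| \<le> m, so it moves the meet \<open>s\<close> by at most such a factor. The conjugates
  \<open>v j\<close> measure this displacement.\<close>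

lemma torsion_of_slow_growth:
  assumes h: "h \<in> carrier G" and n: "n > 0" "k * Suc (card slab) \<le> n"
    and hk: "h [^] (n::nat) \<otimes> z [^] (k::nat) \<in> P" "inv (h [^] n) \<otimes> z [^] k \<in> P"
  shows "\<exists>d>0. h [^] (d::nat) = \<one>"
proof -
  define m where "m = Suc (card slab)"
  have m_pos: "m > 0"
    by (simp add: m_def)
  obtain C where C: "\<And>i::int. h [^] i \<otimes> z [^] (nat \<bar>i\<bar> div m + C) \<in> P"
    using int_pow_slow_growth[OF h n _ hk] by (auto simp: m_def)
  \<comment> \<open>Dividing by \<open>m\<close> is what makes a shift of the index by up to
    \<open>m\<close> change the exponent of z by at most one.\<close>
  define F where "F i = nat \<bar>i\<bar> div m + C" for i :: int
  define x where "x i = h [^] i \<otimes> z [^] F i" for i :: int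
  have xP: "x i \<in> P" for i
    using C by (simp add: x_def F_def)
  have xX: "range x \<subseteq> P" "range x \<noteq> {}"
    using xP by auto
  obtain s where s: "s \<in> P" "\<And>i. s \<preceq> x i" "\<And>y. \<lbrakk>y \<in> carrier G; \<And>i. y \<preceq> x i\<rbrakk> \<Longrightarrow> y \<preceq> s"
    using cone_glb[OF xX] by auto
  have sc: "s \<in> carrier G"
    using s(1) by simp
  define v where "v j = inv s \<otimes> (h [^] j \<otimes> s)" for j :: int
  have vc: "v j \<in> carrier G" for j
    using h sc by (simp add: v_def)
  have vz: "v j \<otimes> z \<in> P" if j: "\<bar>j\<bar> \<le> int m" for j
  proof -
    \<comment> \<open>Chosen so that y \<preceq> s unfolds to v j \<otimes> z \<in> P. As
      \<open>s\<close> is a greatest lower bound, it suffices that \<open>y\<close> is below every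
      \<open>x i\<close>, and for this s \<preceq> x (i + j) is translated by h^(-j).\<close>
    define y where "y = inv z \<otimes> (h [^] (-j) \<otimes> s)"
    have yc: "y \<in> carrier G"
      using h sc by (simp add: y_def)
    have "y \<preceq> x i" for i
    proof -
      have hs: "h [^] (-j) \<otimes> s \<preceq> h [^] (-j) \<otimes> x (i + j)"
        using s(2)[of "i + j"] h sc xP cone_le_translate by simp
      have "h [^] (-j) \<otimes> x (i + j) = h [^] i \<otimes> z [^] F (i + j)"
        using h int_pow_mult[of h j i]
        by (simp add: x_def add.commute[of i j] int_pow_neg m_assoc inv_mult_cancel)
      moreover have "h [^] i \<otimes> z [^] F (i + j) \<preceq> z \<otimes> x i"
      proof -
        have "nat \<bar>i + j\<bar> \<le> nat \<bar>i\<bar> + m"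
          using j by linarith
        then have "nat \<bar>i + j\<bar> div m \<le> (nat \<bar>i\<bar> + m) div m"
          by (rule div_le_mono)
        then have "F (i + j) \<le> Suc (F i)"
          by (simp add: F_def m_pos)
        then obtain d where d: "Suc (F i) = F (i + j) + d"
          using le_Suc_ex by blast
        have "z \<otimes> x i = h [^] i \<otimes> z [^] Suc (F i)"
          unfolding x_def using h z_central[of "h [^] i \<otimes> z [^] F i"] by (simp add: m_assoc)
        also have "\<dots> = (h [^] i \<otimes> z [^] F (i + j)) \<otimes> z [^] d"
          unfolding d using h by (simp add: m_assoc flip: nat_pow_mult)
        finally have "inv (h [^] i \<otimes> z [^] F (i + j)) \<otimes> (z \<otimes> x i) = z [^] d"
          using h by (simp add: inv_mult_cancel)
        then show ?thesis
          using z_pow_in_P by (simp add: cone_le_def)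
      qed
      ultimately have "h [^] (-j) \<otimes> x (i + j) \<preceq> z \<otimes> x i"
        by (simp only:)
      then have "h [^] (-j) \<otimes> s \<preceq> z \<otimes> x i"
        by (rule cone_le_trans[rotated 4]) (use hs h sc xP in simp_all)
      moreover have "h [^] (-j) \<otimes> s = z \<otimes> y"
        using h sc by (simp add: y_def inv_mult_cancel)
      ultimately show ?thesis
        using cone_le_translate[OF z_carrier yc, of "x i"] xP by simp
    qed
    then have "y \<preceq> s"
      using s(3) yc by blast
    moreover have "inv y \<otimes> s = v j \<otimes> z"
      unfolding y_def v_def using h sc z_central[of "inv s \<otimes> (h [^] j \<otimes> s)"] z_central[of s]
      by (simp add: inv_mult_group int_pow_neg m_assoc)
    ultimately show ?thesis
      by (simp add: cone_le_def)
  qed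
  have inv_v: "inv (v j) = v (- j)" for j
    using h sc by (simp add: v_def inv_mult_group int_pow_neg m_assoc)
  \<comment> \<open>The second condition of the slab for \<open>v j\<close> is the first one for
    \<open>v (- j)\<close>. There are m + 1 indices and fewer than m elements of the slab plus one,
    so two values coincide.\<close>
  have "v ` {0..int m} \<subseteq> slab"
    using vz vc by (auto simp: slab_def inv_v)
  then have "\<not> inj_on v {0..int m}"
    using card_inj_on_le[OF _ _ finite_slab, of v "{0..int m}"] by (auto simp: m_def)
  then obtain i j where ij: "i \<noteq> j" "v i = v j"
    by (auto simp: inj_on_def)
  then have "h [^] i = h [^] j"
    using h sc by (simp add: v_def)
  then have "h [^] (i - j) = \<one>" "h [^] (j - i) = \<one>"
    using h by (simp_all add: int_pow_diff)
  then have "h [^] (nat \<bar>i - j\<bar>) = \<one>"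
    by (cases "i \<ge> j") (simp_all flip: int_pow_int)
  then show ?thesis
    using ij(1) by (intro exI[of _ "nat \<bar>i - j\<bar>"]) simp
qed

end

section \<open>A growth rate for powers that is uniform in the element\<close>

context lattice_cone
begin

text \<open>One exponent suffices for the finitely many letters, and since z is central the
  exponents add along a word. Inverses are carried along because
  \<open>torsion_of_slow_growth\<close> needs a power bounded on both sides.\<close>

lemma absorb_word_length:
  assumes S: "finite_generating_set G S"
  shows "\<exists>\<kappa>::nat. \<forall>g\<in>carrier G.
    g \<otimes> z [^] (\<kappa> * word_length G S g) \<in> P \<and> inv g \<otimes> z [^] (\<kappa> * word_length G S g) \<in> P"
proof -
  let ?X = "S \<union> m_inv G ` S"
  have X: "finite ?X" "?X \<subseteq> carrier G"
    using S by (auto simp: finite_generating_set_def)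
  have inv_X: "inv x \<in> ?X" if "x \<in> ?X" for x
    using that S by (auto simp: finite_generating_set_def)
  obtain \<kappa> :: nat where \<kappa>: "\<And>x. x \<in> ?X \<Longrightarrow> x \<otimes> z [^] \<kappa> \<in> P"
    using absorb_uniform[OF X] by blast
  have word: "list_prod G ws \<otimes> z [^] (\<kappa> * length ws) \<in> P \<and>
      inv (list_prod G ws) \<otimes> z [^] (\<kappa> * length ws) \<in> P" if "set ws \<subseteq> ?X" for ws
    using that
  proof (induction ws)
    case (Cons x ws)
    have x: "x \<in> ?X" and ws: "set ws \<subseteq> ?X"
      using Cons.prems by auto
    have xc: "x \<in> carrier G" and wc: "list_prod G ws \<in> carrier G"
      using x ws X(2) by (blast, blast intro: list_prod_closed)
    have len: "\<kappa> * length (x # ws) = \<kappa> + \<kappa> * length ws"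
      by simp
    have "(x \<otimes> list_prod G ws) \<otimes> z [^] (\<kappa> + \<kappa> * length ws) \<in> P"
      using Cons.IH[OF ws] \<kappa>[OF x] xc wc by (intro mult_z_pow_in_P) auto
    moreover have "(inv (list_prod G ws) \<otimes> inv x) \<otimes> z [^] (\<kappa> * length ws + \<kappa>) \<in> P"
      using Cons.IH[OF ws] \<kappa>[OF inv_X[OF x]] xc wc by (intro mult_z_pow_in_P) auto
    ultimately show ?case
      unfolding len using xc wc by (simp add: inv_mult_group add.commute)
  qed (simp add: one_in_P)
  show ?thesis
  proof (intro exI ballI)
    fix g assume g: "g \<in> carrier G"
    obtain ws where "length ws = word_length G S g" "set ws \<subseteq> ?X" "list_prod G ws = g"
      using word_length_witness[OF S g] by blast
    then show "g \<otimes> z [^] (\<kappa> * word_length G S g) \<in> P \<and> inv g \<otimes> z [^] (\<kappa> * word_length G S g) \<in> P"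
      using word[of ws] by simp
  qed
qed

text \<open>The contrapositive of \<open>torsion_of_slow_growth\<close>, with the exponent of z
  supplied by word length. The rate involves only \<open>\<kappa>\<close> and the size of the slab,
  so it is the same for every \<open>h\<close>.\<close>

lemma uniform_power_growth:
  assumes S: "finite_generating_set G S"
  shows "\<exists>c>0::real. \<forall>h\<in>carrier G. \<forall>n>0. (\<forall>d>0. h [^] (d::nat) \<noteq> \<one>) \<longrightarrow>
    c * real n \<le> word_length G S (h [^] (n::nat))"
proof -
  obtain \<kappa> :: nat where \<kappa>: "\<And>g. g \<in> carrier G \<Longrightarrow>
      g \<otimes> z [^] (\<kappa> * word_length G S g) \<in> P \<and> inv g \<otimes> z [^] (\<kappa> * word_length G S g) \<in> P"
    using absorb_word_length[OF S] by blast
  define m where "m = Suc (card slab)"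
  \<comment> \<open>\<open>Suc \<kappa>\<close> keeps \<open>K\<close> positive when
    \<open>\<kappa>\<close> is 0.\<close>
  define K where "K = Suc \<kappa> * m"
  define c where "c = 1 / real K"
  have K: "K > 0"
    by (simp add: K_def m_def)
  then have c: "c > 0"
    by (simp add: c_def)
  have "c * real n \<le> word_length G S (h [^] n)"
    if h: "h \<in> carrier G" and n: "n > 0" and free: "\<forall>d>0. h [^] (d::nat) \<noteq> \<one>" for h and n :: nat
  proof -
    let ?l = "word_length G S (h [^] n)"
    have "\<not> \<kappa> * ?l * m \<le> n"
      using torsion_of_slow_growth[OF h n, of "\<kappa> * ?l"] \<kappa>[of "h [^] n"] h free by (auto simp: m_def)
    then have "n \<le> \<kappa> * ?l * m"
      by simp
    also have "\<dots> \<le> K * ?l"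
      by (simp add: K_def)
    finally have "real n \<le> real K * ?l"
      by (metis of_nat_le_iff of_nat_mult)
    then show ?thesis
      using K by (simp add: c_def pos_divide_le_eq mult.commute)
  qed
  then show ?thesis
    using c by blast
qed

end

section \<open>The positive cone of a Garside group\<close>

context garside_monoid
begin

lemma atoms_carrier: "atoms M \<subseteq> carrier M"
  by (auto simp: atoms_def)

text \<open>An atom occurs as a letter in every word that represents it, so every generating set
  contains all atoms.\<close>

lemma finite_atoms: "finite (atoms M)"
proof -
  obtain S where S: "finite S" "S \<subseteq> carrier M" "\<forall>a\<in>carrier M. \<exists>ws. set ws \<subseteq> S \<and> list_prod M ws = a"
    using finitely_generated by (auto simp: monoid_generated_by_def)
  have "atoms M \<subseteq> S"
  proof
    fix a assume a: "a \<in> atoms M"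
    then obtain ws where "set ws \<subseteq> S" "list_prod M ws = a"
      using S atoms_carrier by blast
    then show "a \<in> S"
      using atom_in_factors[of ws] a S(2) by auto
  qed
  then show ?thesis
    using S(1) finite_subset by blast
qed

lemma atom_word:
  assumes "a \<in> carrier M"
  obtains ws where "set ws \<subseteq> atoms M" "list_prod M ws = a"
  using assms atoms_generate by (auto simp: monoid_generated_by_def)

text \<open>An atom word of a divisor extends to an atom word of \<open>u\<close>, so its length is
  at most the maximal atom length of \<open>u\<close>. Only finitely many words over the finitely
  many atoms are that short.\<close>

lemma finite_left_divisors:
  assumes u: "u \<in> carrier M"
  shows "finite {p \<in> carrier M. left_le M p u}"
proof -
  obtain m where m: "max_atom_length M u = enat m"
    using max_atom_length_finite[OF u] by (cases "max_atom_length M u") auto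
  have "{p \<in> carrier M. left_le M p u} \<subseteq> list_prod M ` {ws. set ws \<subseteq> atoms M \<and> length ws \<le> m}"
  proof clarify
    fix p assume p: "p \<in> carrier M" "left_le M p u"
    then obtain c where c: "c \<in> carrier M" "p \<otimes> c = u"
      by (auto simp: left_le_def)
    obtain us vs where us: "set us \<subseteq> atoms M" "list_prod M us = p"
      and vs: "set vs \<subseteq> atoms M" "list_prod M vs = c"
      using atom_word p c by metis
    then have "list_prod M (us @ vs) = u" "set (us @ vs) \<subseteq> atoms M"
      using list_prod_append[of us vs] atoms_carrier c by auto
    then have "enat (length (us @ vs)) \<le> max_atom_length M u"
      unfolding max_atom_length_def by (intro Sup_upper) blast
    then have "length us \<le> m"
      by (simp add: m)
    then show "p \<in> list_prod M ` {ws. set ws \<subseteq> atoms M \<and> length ws \<le> m}"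
      using us by blast
  qed
  then show ?thesis
    by (rule finite_subset) (intro finite_imageI finite_lists_length_le finite_atoms)
qed

lemma left_join:
  assumes "a \<in> carrier M" "b \<in> carrier M"
  shows "\<exists>c\<in>carrier M. left_le M a c \<and> left_le M b c \<and>
    (\<forall>d\<in>carrier M. left_le M a d \<longrightarrow> left_le M b d \<longrightarrow> left_le M c d)"
proof -
  interpret L: lattice "\<lparr>carrier = carrier M, eq = (=), le = left_le M\<rparr>"
    by (rule left_lattice)
  show ?thesis
    using L.sup_of_two_exists[of a b] assms by (auto simp: least_def Upper_def)
qed

text \<open>
  Conjugation by \<open>\<Delta>\<close> injects the finite set of its divisors into itself,
  so some power of it is the identity on this generating set.
\<close>
lemma central_garside_power:
  assumes "garside_element M \<Delta>"
  shows "\<exists>e>0. \<forall>a\<in>carrier M. a \<otimes> \<Delta> [^] (e::nat) = \<Delta> [^] e \<otimes> a"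
proof -
  define D where "D = {a \<in> carrier M. left_le M a \<Delta>}"
  have Delta: "\<Delta> \<in> carrier M" and D_gen: "monoid_generated_by M D"
    and D_right: "\<And>a. a \<in> carrier M \<Longrightarrow> left_le M a \<Delta> \<longleftrightarrow> right_le M a \<Delta>"
    using assms by (auto simp: garside_element_def D_def)
  have finD: "finite D"
    using finite_left_divisors[OF Delta] by (simp add: D_def)
  \<comment> \<open>Taking complements twice: if d c = \<Delta> and c t = \<Delta>, then d \<Delta>
    = d c t = \<Delta> t. That left and right divisors of \<Delta> agree keeps \<open>c\<close> and
    \<open>t\<close> among them.\<close>
  have "\<forall>d\<in>D. \<exists>t\<in>D. d \<otimes> \<Delta> = \<Delta> \<otimes> t"
  proof
    fix d assume d: "d \<in> D"
    then obtain c where c: "c \<in> carrier M" "d \<otimes> c = \<Delta>"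
      by (auto simp: D_def left_le_def)
    then have "left_le M c \<Delta>"
      using D_right d by (auto simp: right_le_def D_def)
    then obtain t where t: "t \<in> carrier M" "c \<otimes> t = \<Delta>"
      by (auto simp: left_le_def)
    then have "t \<in> D"
      using D_right c by (auto simp: right_le_def D_def)
    moreover have "d \<otimes> \<Delta> = \<Delta> \<otimes> t"
      using c t d by (auto simp: D_def m_assoc)
    ultimately show "\<exists>t\<in>D. d \<otimes> \<Delta> = \<Delta> \<otimes> t"
      by blast
  qed
  then obtain \<tau> where tau: "\<And>d. d \<in> D \<Longrightarrow> \<tau> d \<in> D" "\<And>d. d \<in> D \<Longrightarrow> d \<otimes> \<Delta> = \<Delta> \<otimes> \<tau> d"
    by metis
  have D_carrier: "d \<in> D \<Longrightarrow> d \<in> carrier M" for d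
    by (simp add: D_def)
  have tau_pow: "(\<tau> ^^ n) d \<in> D \<and> d \<otimes> \<Delta> [^] n = \<Delta> [^] n \<otimes> (\<tau> ^^ n) d" if "d \<in> D" for n d
  proof (induction n)
    case (Suc n)
    let ?t = "(\<tau> ^^ n) d"
    have "d \<otimes> \<Delta> [^] Suc n = (\<Delta> [^] n \<otimes> ?t) \<otimes> \<Delta>"
      using Suc D_carrier that Delta by (simp flip: m_assoc)
    also have "\<dots> = \<Delta> [^] n \<otimes> (\<Delta> \<otimes> \<tau> ?t)"
      using Suc D_carrier Delta tau by (simp add: m_assoc)
    also have "\<dots> = \<Delta> [^] Suc n \<otimes> \<tau> ?t"
      using Suc D_carrier Delta tau by (simp add: m_assoc)
    finally show ?case
      using Suc tau by simp
  qed (use that D_carrier in auto)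
  \<comment> \<open>Restricted to \<open>D\<close>, the iterates of \<open>\<tau>\<close> lie in a
    finite function space, so two of them agree.\<close>
  define r where "r n = restrict (\<tau> ^^ n) D" for n
  have "range r \<subseteq> D \<rightarrow>\<^sub>E D"
    using tau_pow by (auto simp: r_def)
  then have "finite (range r)"
    using finD finite_PiE[of D "\<lambda>_. D"] finite_subset by blast
  then have "\<not> inj r"
    using finite_imageD by blast
  then obtain i j where ij: "r i = r j" "i < j"
    by (metis injI linorder_neqE_nat)
  then have same: "(\<tau> ^^ i) d = (\<tau> ^^ j) d" if "d \<in> D" for d
    using that by (metis r_def restrict_apply')
  define e where "e = j - i"
  have D_central: "d \<otimes> \<Delta> [^] e = \<Delta> [^] e \<otimes> d" if d: "d \<in> D" for d
  proof -
    have dM: "d \<in> carrier M" and tM: "(\<tau> ^^ i) d \<in> carrier M"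
      using d tau_pow[OF d, of i] D_carrier by blast+
    have dj: "d \<otimes> \<Delta> [^] j = \<Delta> [^] j \<otimes> (\<tau> ^^ i) d" and di: "d \<otimes> \<Delta> [^] i = \<Delta> [^] i \<otimes> (\<tau> ^^ i) d"
      using tau_pow[OF d] same[OF d] by metis+
    have j: "\<Delta> [^] j = \<Delta> [^] e \<otimes> \<Delta> [^] i"
      using ij Delta by (simp add: e_def nat_pow_mult)
    \<comment> \<open>The i-th and j-th iterates agree, but neither is known to be the identity;
      right cancellation of \<Delta>^i turns their agreement into commutation with \<Delta>^(j -
      i).\<close>
    have "(d \<otimes> \<Delta> [^] e) \<otimes> \<Delta> [^] i = \<Delta> [^] e \<otimes> (\<Delta> [^] i \<otimes> (\<tau> ^^ i) d)"
      using dj dM tM Delta by (simp add: j m_assoc)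
    also have "\<dots> = (\<Delta> [^] e \<otimes> d) \<otimes> \<Delta> [^] i"
      using dM Delta di by (simp add: m_assoc)
    finally show ?thesis
      by (rule r_cancel) (use dM Delta in auto)
  qed
  have "list_prod M ws \<otimes> \<Delta> [^] e = \<Delta> [^] e \<otimes> list_prod M ws" if "set ws \<subseteq> D" for ws
    using that
  proof (induction ws)
    case (Cons d ws)
    have w: "list_prod M ws \<in> carrier M" "d \<in> carrier M" "\<Delta> [^] e \<in> carrier M"
      using Cons.prems D_carrier Delta by (auto intro!: list_prod_closed)
    have "list_prod M (d # ws) \<otimes> \<Delta> [^] e = d \<otimes> (\<Delta> [^] e \<otimes> list_prod M ws)"
      using Cons w by (simp add: m_assoc)
    also have "\<dots> = \<Delta> [^] e \<otimes> list_prod M (d # ws)"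
      using D_central[of d] Cons.prems w by (simp flip: m_assoc)
    finally show ?case .
  qed (use Delta in simp)
  then have "\<forall>a\<in>carrier M. a \<otimes> \<Delta> [^] e = \<Delta> [^] e \<otimes> a"
    using D_gen by (metis monoid_generated_by_def)
  then show ?thesis
    using ij by (intro exI[of _ e]) (simp add: e_def)
qed

end

text \<open>The witnesses are the image of the monoid and of a central power of \<Delta>. Via
  \<open>le_iff\<close>, the finiteness and join axioms become statements about left divisibility;
  \<open>absorb\<close> comes from the generation of the monoid by divisors of \<Delta>.\<close>

lemma garside_group_cone:
  assumes M: "garside_monoid M" and frac: "group_of_fractions M G \<iota>"
  shows "\<exists>P z. lattice_cone G P z"
proof -
  interpret M: garside_monoid M by (rule M)
  interpret G: group G using frac by (simp add: group_of_fractions_def)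
  have \<iota>: "\<iota> \<in> hom M G" "inj_on \<iota> (carrier M)"
    and G_carrier: "carrier G = {inv\<^bsub>G\<^esub> (\<iota> a) \<otimes>\<^bsub>G\<^esub> \<iota> b | a b. a \<in> carrier M \<and> b \<in> carrier M}"
    using frac by (auto simp: group_of_fractions_def mon_def)
  have \<iota>_closed: "\<iota> a \<in> carrier G" if "a \<in> carrier M" for a
    using \<iota>(1) that by (auto simp: hom_def)
  have \<iota>_mult: "\<iota> (a \<otimes>\<^bsub>M\<^esub> b) = \<iota> a \<otimes>\<^bsub>G\<^esub> \<iota> b" if "a \<in> carrier M" "b \<in> carrier M" for a b
    using \<iota>(1) that by (auto simp: hom_def)
  have \<iota>_one: "\<iota> \<one>\<^bsub>M\<^esub> = \<one>\<^bsub>G\<^esub>"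
    using \<iota>_mult[of "\<one>\<^bsub>M\<^esub>" "\<one>\<^bsub>M\<^esub>"] \<iota>_closed[of "\<one>\<^bsub>M\<^esub>"] G.l_cancel_one' by fastforce
  define P where "P = \<iota> ` carrier M"
  have le_iff: "inv\<^bsub>G\<^esub> (\<iota> a) \<otimes>\<^bsub>G\<^esub> \<iota> b \<in> P \<longleftrightarrow> left_le M a b"
    if ab: "a \<in> carrier M" "b \<in> carrier M" for a b
  proof -
    have "inv\<^bsub>G\<^esub> (\<iota> a) \<otimes>\<^bsub>G\<^esub> \<iota> b = \<iota> c \<longleftrightarrow> a \<otimes>\<^bsub>M\<^esub> c = b" if c: "c \<in> carrier M" for c
    proof -
      have "inv\<^bsub>G\<^esub> (\<iota> a) \<otimes>\<^bsub>G\<^esub> \<iota> b = \<iota> c \<longleftrightarrow> \<iota> b = \<iota> (a \<otimes>\<^bsub>M\<^esub> c)"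
        using ab c \<iota>_closed by (metis G.inv_solve_left' \<iota>_mult)
      also have "\<dots> \<longleftrightarrow> b = a \<otimes>\<^bsub>M\<^esub> c"
        using \<iota>(2) ab c by (simp add: inj_on_eq_iff)
      finally show ?thesis
        by auto
    qed
    then show ?thesis
      by (auto simp: P_def left_le_def)
  qed
  obtain \<Delta> where Delta: "garside_element M \<Delta>"
    using M.garside_element_exists by blast
  then have \<Delta>_carrier: "\<Delta> \<in> carrier M"
    and D_gen: "monoid_generated_by M {a \<in> carrier M. left_le M a \<Delta>}"
    by (auto simp: garside_element_def)
  obtain e :: nat where e: "e > 0" "\<And>a. a \<in> carrier M \<Longrightarrow> a \<otimes>\<^bsub>M\<^esub> \<Delta> [^]\<^bsub>M\<^esub> e = \<Delta> [^]\<^bsub>M\<^esub> e \<otimes>\<^bsub>M\<^esub> a"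
    using M.central_garside_power[OF Delta] by blast
  define y where "y = \<Delta> [^]\<^bsub>M\<^esub> e"
  define z where "z = \<iota> y"
  have y: "y \<in> carrier M" and zP: "z \<in> P" and zG: "z \<in> carrier G"
    using \<Delta>_carrier \<iota>_closed by (auto simp: y_def z_def P_def)
  have P_mult: "p \<otimes>\<^bsub>G\<^esub> q \<in> P" if "p \<in> P" "q \<in> P" for p q
    using that by (auto simp: P_def simp flip: \<iota>_mult)
  have P_G: "P \<subseteq> carrier G"
    using \<iota>_closed by (auto simp: P_def)
  have z_comm: "\<iota> a \<otimes>\<^bsub>G\<^esub> z = z \<otimes>\<^bsub>G\<^esub> \<iota> a" if "a \<in> carrier M" for a
    using e(2)[OF that] that y by (simp add: z_def y_def flip: \<iota>_mult)
  have z_central: "x \<otimes>\<^bsub>G\<^esub> z = z \<otimes>\<^bsub>G\<^esub> x" if x: "x \<in> carrier G" for x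
  proof -
    obtain a b where ab: "a \<in> carrier M" "b \<in> carrier M" "x = inv\<^bsub>G\<^esub> (\<iota> a) \<otimes>\<^bsub>G\<^esub> \<iota> b"
      using x G_carrier by auto
    have "inv\<^bsub>G\<^esub> (\<iota> a) \<otimes>\<^bsub>G\<^esub> z = z \<otimes>\<^bsub>G\<^esub> inv\<^bsub>G\<^esub> (\<iota> a)"
      using z_comm[OF ab(1)] \<iota>_closed[OF ab(1)] zG
      by (metis G.inv_closed G.inv_solve_left G.inv_solve_right' G.m_assoc G.m_closed)
    then show ?thesis
      using z_comm[OF ab(2)] \<iota>_closed ab zG by (metis G.inv_closed G.m_assoc)
  qed
  \<comment> \<open>One factor z is spent per letter: a letter divides \<Delta>, which divides
    \<open>y\<close> because e > 0, so its inverse times z is positive.\<close>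
  have inv_absorb: "\<exists>k::nat. inv\<^bsub>G\<^esub> (\<iota> (list_prod M ws)) \<otimes>\<^bsub>G\<^esub> z [^]\<^bsub>G\<^esub> k \<in> P"
    if "set ws \<subseteq> {a \<in> carrier M. left_le M a \<Delta>}" for ws
    using that
  proof (induction ws)
    case Nil
    then show ?case
      by (intro exI[of _ 0]) (simp add: \<iota>_one P_def, metis M.one_closed \<iota>_one imageI)
  next
    case (Cons d ws)
    let ?w = "list_prod M ws"
    have w: "?w \<in> carrier M" and d: "d \<in> carrier M" "left_le M d \<Delta>"
      using Cons.prems by (auto intro!: M.list_prod_closed)
    obtain k :: nat where k: "inv\<^bsub>G\<^esub> (\<iota> ?w) \<otimes>\<^bsub>G\<^esub> z [^]\<^bsub>G\<^esub> k \<in> P"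
      using Cons by auto
    have "y = \<Delta> \<otimes>\<^bsub>M\<^esub> \<Delta> [^]\<^bsub>M\<^esub> (e - 1)"
      using e(1) \<Delta>_carrier M.nat_pow_Suc2[of \<Delta> "e - 1"] by (simp add: y_def del: M.nat_pow_Suc)
    then have "left_le M \<Delta> y"
      using \<Delta>_carrier by (auto simp: left_le_def)
    then have "left_le M d y"
      using d \<Delta>_carrier y by (auto simp: left_le_def M.m_assoc)
    then have dz: "inv\<^bsub>G\<^esub> (\<iota> d) \<otimes>\<^bsub>G\<^esub> z \<in> P"
      using le_iff d y by (simp add: z_def)
    have "inv\<^bsub>G\<^esub> (\<iota> (list_prod M (d # ws))) \<otimes>\<^bsub>G\<^esub> z [^]\<^bsub>G\<^esub> Suc k =
        (inv\<^bsub>G\<^esub> (\<iota> ?w) \<otimes>\<^bsub>G\<^esub> z [^]\<^bsub>G\<^esub> k) \<otimes>\<^bsub>G\<^esub> (inv\<^bsub>G\<^esub> (\<iota> d) \<otimes>\<^bsub>G\<^esub> z)"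
    proof -
      have "inv\<^bsub>G\<^esub> (\<iota> d) \<otimes>\<^bsub>G\<^esub> z [^]\<^bsub>G\<^esub> k = z [^]\<^bsub>G\<^esub> k \<otimes>\<^bsub>G\<^esub> inv\<^bsub>G\<^esub> (\<iota> d)"
      proof (induction k)
        case (Suc k)
        then show ?case
          using z_central[of "inv\<^bsub>G\<^esub> (\<iota> d)"] \<iota>_closed[OF d(1)] zG
          by simp (metis G.inv_closed G.m_assoc G.nat_pow_closed)
      qed (use \<iota>_closed[OF d(1)] in simp)
      then have "inv\<^bsub>G\<^esub> (\<iota> d) \<otimes>\<^bsub>G\<^esub> (z [^]\<^bsub>G\<^esub> k \<otimes>\<^bsub>G\<^esub> z) =
          z [^]\<^bsub>G\<^esub> k \<otimes>\<^bsub>G\<^esub> (inv\<^bsub>G\<^esub> (\<iota> d) \<otimes>\<^bsub>G\<^esub> z)"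
        using \<iota>_closed[OF d(1)] zG by (simp flip: G.m_assoc)
      then show ?thesis
        using \<iota>_closed d w zG by (simp add: \<iota>_mult G.inv_mult_group G.m_assoc)
    qed
    then show ?case
      using P_mult[OF k dz] by metis
  qed
  have absorb: "\<exists>k::nat. x \<otimes>\<^bsub>G\<^esub> z [^]\<^bsub>G\<^esub> k \<in> P" if x: "x \<in> carrier G" for x
  proof -
    obtain a b where ab: "a \<in> carrier M" "b \<in> carrier M" "x = inv\<^bsub>G\<^esub> (\<iota> a) \<otimes>\<^bsub>G\<^esub> \<iota> b"
      using x G_carrier by auto
    obtain ws where "set ws \<subseteq> {a \<in> carrier M. left_le M a \<Delta>}" "list_prod M ws = a"
      using D_gen ab(1) by (auto simp: monoid_generated_by_def)
    then obtain k :: nat where k: "inv\<^bsub>G\<^esub> (\<iota> a) \<otimes>\<^bsub>G\<^esub> z [^]\<^bsub>G\<^esub> k \<in> P"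
      using inv_absorb by blast
    have "\<iota> b \<otimes>\<^bsub>G\<^esub> z [^]\<^bsub>G\<^esub> k = z [^]\<^bsub>G\<^esub> k \<otimes>\<^bsub>G\<^esub> \<iota> b"
    proof (induction k)
      case (Suc k)
      then show ?case
        using z_comm[OF ab(2)] \<iota>_closed[OF ab(2)] zG
        by simp (metis G.m_assoc G.nat_pow_closed)
    qed (use \<iota>_closed[OF ab(2)] in simp)
    then have "x \<otimes>\<^bsub>G\<^esub> z [^]\<^bsub>G\<^esub> k = (inv\<^bsub>G\<^esub> (\<iota> a) \<otimes>\<^bsub>G\<^esub> z [^]\<^bsub>G\<^esub> k) \<otimes>\<^bsub>G\<^esub> \<iota> b"
      using ab \<iota>_closed zG by (simp add: G.m_assoc)
    then show ?thesis
      using P_mult[OF k, of "\<iota> b"] ab(2) by (metis P_def imageI)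
  qed
  have "lattice_cone G P z"
  proof (unfold_locales)
    show "\<one>\<^bsub>G\<^esub> \<in> P"
      using \<iota>_one by (metis M.one_closed P_def imageI)
    show "finite {p \<in> P. inv\<^bsub>G\<^esub> p \<otimes>\<^bsub>G\<^esub> u \<in> P}" if u: "u \<in> P" for u
    proof -
      obtain b where b: "b \<in> carrier M" "u = \<iota> b"
        using u by (auto simp: P_def)
      have "{p \<in> P. inv\<^bsub>G\<^esub> p \<otimes>\<^bsub>G\<^esub> u \<in> P} \<subseteq> \<iota> ` {a \<in> carrier M. left_le M a b}"
        using le_iff b by (auto simp: P_def[symmetric]) (auto simp: P_def)
      then show ?thesis
        using M.finite_left_divisors[OF b(1)] finite_subset by blast
    qed
    show "\<exists>c\<in>P. inv\<^bsub>G\<^esub> p \<otimes>\<^bsub>G\<^esub> c \<in> P \<and> inv\<^bsub>G\<^esub> q \<otimes>\<^bsub>G\<^esub> c \<in> P \<and>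
        (\<forall>d\<in>P. inv\<^bsub>G\<^esub> p \<otimes>\<^bsub>G\<^esub> d \<in> P \<longrightarrow> inv\<^bsub>G\<^esub> q \<otimes>\<^bsub>G\<^esub> d \<in> P \<longrightarrow> inv\<^bsub>G\<^esub> c \<otimes>\<^bsub>G\<^esub> d \<in> P)"
      if pq: "p \<in> P" "q \<in> P" for p q
    proof -
      obtain a b where ab: "a \<in> carrier M" "p = \<iota> a" "b \<in> carrier M" "q = \<iota> b"
        using pq by (auto simp: P_def)
      obtain c where c: "c \<in> carrier M" "left_le M a c" "left_le M b c"
        "\<And>d. \<lbrakk>d \<in> carrier M; left_le M a d; left_le M b d\<rbrakk> \<Longrightarrow> left_le M c d"
        using M.left_join[OF ab(1,3)] by blast
      have "\<iota> c \<in> P"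
        using c(1) by (simp add: P_def)
      moreover have "inv\<^bsub>G\<^esub> (\<iota> c) \<otimes>\<^bsub>G\<^esub> d \<in> P"
        if d: "d \<in> P" "inv\<^bsub>G\<^esub> p \<otimes>\<^bsub>G\<^esub> d \<in> P" "inv\<^bsub>G\<^esub> q \<otimes>\<^bsub>G\<^esub> d \<in> P" for d
      proof -
        obtain d' where "d' \<in> carrier M" "d = \<iota> d'"
          using d(1) by (auto simp: P_def)
        then show ?thesis
          using d(2,3) ab c le_iff by simp
      qed
      ultimately show ?thesis
        using c ab le_iff by (intro bexI[of _ "\<iota> c"]) auto
    qed
  qed (use P_G P_mult zP z_central absorb in auto)
  then show ?thesis
    by blast
qed

section \<open>Comparison of the two word metrics\<close>

theorem theoremB:
  fixes M :: "('m, 'x) monoid_scheme"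
    and G :: "('g, 'y) monoid_scheme"
    and A :: "('a, 'z) monoid_scheme"
    and \<iota> :: "'m \<Rightarrow> 'g"
    and \<phi> :: "'a \<Rightarrow> 'g"
  assumes "garside_monoid M"
    and "group_of_fractions M G \<iota>"
    and "comm_group A"
    and "finite_generating_set A S"
    and "finite_generating_set G T"
    and "\<phi> \<in> mon A G"
  shows "quasi_isometric_embedding (carrier A) (word_dist A S) (carrier G) (word_dist G T) \<phi>"
proof -
  obtain P z where "lattice_cone G P z"
    using garside_group_cone assms(1,2) by blast
  then interpret G: lattice_cone G P z .
  interpret A: comm_group A by (rule assms(3))
  interpret \<phi>: group_hom A G \<phi>
    using assms(6) by unfold_locales (simp add: mon_def)
  have inj: "inj_on \<phi> (carrier A)"
    using assms(6) by (simp add: mon_def)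
  define L where "L a = real (word_length G T (\<phi> a))" for a
  have L_one: "L \<one>\<^bsub>A\<^esub> = 0"
    by (simp add: L_def G.word_length_one)
  have L_nonneg: "L a \<ge> 0" for a
    by (simp add: L_def)
  have L_mult: "L (a \<otimes>\<^bsub>A\<^esub> b) \<le> L a + L b" if "a \<in> carrier A" "b \<in> carrier A" for a b
    using G.word_length_mult[OF assms(5), of "\<phi> a" "\<phi> b"] that
    by (simp add: L_def flip: of_nat_add)
  obtain c where c: "c > 0" and growth: "\<And>h n. \<lbrakk>h \<in> carrier G; n > 0; \<forall>d>0. h [^]\<^bsub>G\<^esub> (d::nat) \<noteq> \<one>\<^bsub>G\<^esub>\<rbrakk> \<Longrightarrow>
      c * real n \<le> word_length G T (h [^]\<^bsub>G\<^esub> (n::nat))"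
    using G.uniform_power_growth[OF assms(5)] by blast
  have L_growth: "c * real n \<le> L (a [^]\<^bsub>A\<^esub> (n::nat))"
    if a: "a \<in> carrier A" and free: "\<forall>d>0. a [^]\<^bsub>A\<^esub> (d::nat) \<noteq> \<one>\<^bsub>A\<^esub>" and n: "n > 0" for a n
  proof -
    \<comment> \<open>Injectivity of \<open>\<phi>\<close> enters here: it preserves infinite order,
      so the growth rate of \<open>G\<close> applies to the image of \<open>a\<close>.\<close>
    have "\<phi> a [^]\<^bsub>G\<^esub> d \<noteq> \<one>\<^bsub>G\<^esub>" if "d > 0" for d :: nat
    proof
      assume "\<phi> a [^]\<^bsub>G\<^esub> d = \<one>\<^bsub>G\<^esub>"
      then have "\<phi> (a [^]\<^bsub>A\<^esub> d) = \<phi> \<one>\<^bsub>A\<^esub>"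
        using a by (simp add: \<phi>.hom_nat_pow)
      then have "a [^]\<^bsub>A\<^esub> d = \<one>\<^bsub>A\<^esub>"
        by (rule inj_onD[OF inj]) (use a in simp_all)
      then show False
        using free that by blast
    qed
    then show ?thesis
      using growth[of "\<phi> a" n] a n by (simp add: L_def \<phi>.hom_nat_pow)
  qed
  obtain C :: real where upper: "\<And>a. a \<in> carrier A \<Longrightarrow> L a \<le> C * word_length A S a"
    using A.subadditive_linear_bound[where L = L, OF assms(4) L_one L_nonneg L_mult] by blast
  obtain \<kappa> B :: real where \<kappa>: "\<kappa> > 0" and B: "B \<ge> 0"
    and lower: "\<And>a. a \<in> carrier A \<Longrightarrow> \<kappa> * word_length A S a - B \<le> L a"
    using A.linear_lower_bound[where L = L, OF assms(4) L_one L_nonneg L_mult c L_growth] by blast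
  \<comment> \<open>\<open>C\<close> is the multiplicative constant for the upper bound and 1 /
    \<kappa> the one for the lower bound; only the lower bound produces the additive constant
    \<open>B\<close>.\<close>
  define l where "l = max 1 (max C (1 / \<kappa>))"
  have l: "l \<ge> 1" "C \<le> l" "1 / l \<le> \<kappa>"
  proof -
    show "l \<ge> 1" "C \<le> l"
      by (auto simp: l_def)
    have "1 / \<kappa> \<le> l"
      by (simp add: l_def)
    then show "1 / l \<le> \<kappa>"
      using \<kappa> \<open>l \<ge> 1\<close> by (simp add: field_simps)
  qed
  have "1 / l * word_dist A S x y - B \<le> word_dist G T (\<phi> x) (\<phi> y) \<and>
      word_dist G T (\<phi> x) (\<phi> y) \<le> l * word_dist A S x y + B"
    if xy: "x \<in> carrier A" "y \<in> carrier A" for x y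
  proof -
    define a where "a = inv\<^bsub>A\<^esub> x \<otimes>\<^bsub>A\<^esub> y"
    have a: "a \<in> carrier A"
      using xy by (simp add: a_def)
    have dG: "word_dist G T (\<phi> x) (\<phi> y) = L a"
      using xy by (simp add: word_dist_def L_def a_def)
    have dA: "word_dist A S x y = real (word_length A S a)"
      by (simp add: word_dist_def a_def)
    have "1 / l * word_length A S a \<le> \<kappa> * word_length A S a"
      using l(3) by (rule mult_right_mono) simp
    moreover have "C * word_length A S a \<le> l * word_length A S a"
      using l(2) by (rule mult_right_mono) simp
    ultimately show ?thesis
      using lower[OF a] upper[OF a] B by (simp only: dG dA) linarith
  qed
  then show ?thesis
    unfolding quasi_isometric_embedding_def quasi_isometric_embedding_with_def
    using l(1) B by (intro exI[of _ l] exI[of _ B]) auto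
qed

end
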